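(* Let $G$ be an independent module-composed graph. Then every Lex-BFS (lexicographic breadth-first search) ordering of $G$, which can be computed in time $O(|V_G|+|E_G|)$, is an independent module-sequence for $G$.
   Context: All graphs are finite, simple and undirected. For a graph $G=(V_G,E_G)$ and $v\in V_G$, $N(v)=\{w\in V_G : \{v,w\}\in E_G\}$. A set $M\subseteq V_G$ is a module of $G$ if for all $v_1,v_2\in M$ we have $N(v_1)\setminus M=N(v_2)\setminus M$ (in particular the empty set, singletons and $V_G$ are modules). For $U\subseteq V_G$, $G[U]$ is the induced subgraph on $U$. An independent module-sequence of $G$ is a bijection $\varphi:V_G\to\{1,\ldots,|V_G|\}$ such that for every $2\le i\le |V_G|$ the neighbourhood of $\varphi^{-1}(i)$ in the graph $G[\{\varphi^{-1}(1),\ldots,\varphi^{-1}(i-1)\}]$ is a module of that graph which is an independent set; $G$ is independent module-composed if it has an independent module-sequence. A Lex-BFS ordering is a vertex ordering produced by lexicographic breadth-first search, with $\varphi^{-1}(1)$ the first visited vertex. *)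

theory Defs
  imports Main
begin

section \<open>Graphs, modules and independent module-sequences\<close>

definition simple_graph :: "'a set \<Rightarrow> 'a set set \<Rightarrow> bool" where
  "simple_graph V E \<longleftrightarrow> finite V \<and> (\<forall>e\<in>E. e \<subseteq> V \<and> card e = 2)"

definition neighbours :: "'a set \<Rightarrow> 'a set set \<Rightarrow> 'a \<Rightarrow> 'a set" where
  "neighbours V E v = {w \<in> V. {v, w} \<in> E}"

definition induced_edges :: "'a set set \<Rightarrow> 'a set \<Rightarrow> 'a set set" where
  "induced_edges E U = {e \<in> E. e \<subseteq> U}"

definition is_module :: "'a set \<Rightarrow> 'a set set \<Rightarrow> 'a set \<Rightarrow> bool" where
  "is_module V E M \<longleftrightarrow> M \<subseteq> V \<and>
     (\<forall>v1\<in>M. \<forall>v2\<in>M. neighbours V E v1 - M = neighbours V E v2 - M)"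

definition independent_set :: "'a set \<Rightarrow> 'a set set \<Rightarrow> 'a set \<Rightarrow> bool" where
  "independent_set V E S \<longleftrightarrow> S \<subseteq> V \<and> (\<forall>u\<in>S. \<forall>v\<in>S. {u, v} \<notin> E)"

text \<open>
  The vertex with number i is not a vertex of the graph induced by its predecessors U; its
  neighbourhood there is the set of its neighbours that belong to U.
\<close>

definition independent_module_sequence :: "'a set \<Rightarrow> 'a set set \<Rightarrow> ('a \<Rightarrow> nat) \<Rightarrow> bool" where
  "independent_module_sequence V E \<phi> \<longleftrightarrow> bij_betw \<phi> V {1..card V} \<and>
     (\<forall>i\<in>{2..card V}.
        let v = inv_into V \<phi> i;
            U = inv_into V \<phi> ` {1..i - 1};
            N = neighbours V E v \<inter> U
        in is_module U (induced_edges E U) N \<and> independent_set U (induced_edges E U) N)"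

definition independent_module_composed :: "'a set \<Rightarrow> 'a set set \<Rightarrow> bool" where
  "independent_module_composed V E \<longleftrightarrow> (\<exists>\<phi>. independent_module_sequence V E \<phi>)"

section \<open>Lexicographic breadth-first search\<close>

text \<open>
  A state of the search consists of the list of visited vertices, in the order of their visits,
  and of the labels.  The label of a vertex is the list of the numbers that it received from its
  visited neighbours, the first visited vertex handing out the number card V, the second one
  card V - 1, and so on.  The next visited vertex is any unvisited one whose label is
  lexicographically maximal; a proper prefix is smaller than the longer list.
\<close>

inductive lex_bfs_run :: "'a set \<Rightarrow> 'a set set \<Rightarrow> 'a list \<Rightarrow> ('a \<Rightarrow> nat list) \<Rightarrow> bool"
  for V :: "'a set" and E :: "'a set set" where
  init: "lex_bfs_run V E [] (\<lambda>_. [])"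
| visit: "lex_bfs_run V E (vs @ [v])
            (\<lambda>w. if w \<in> neighbours V E v - set vs then lab w @ [card V - length vs] else lab w)"
  if "lex_bfs_run V E vs lab" and "v \<in> V - set vs"
    and "\<forall>w \<in> V - set vs. (lab v, lab w) \<notin> lexord less_than"

definition lex_bfs_ordering :: "'a set \<Rightarrow> 'a set set \<Rightarrow> ('a \<Rightarrow> nat) \<Rightarrow> bool" where
  "lex_bfs_ordering V E \<phi> \<longleftrightarrow> bij_betw \<phi> V {1..card V} \<and>
     (\<exists>lab. lex_bfs_run V E (map (inv_into V \<phi>) [1..<Suc (card V)]) lab)"

section \<open>A random access machine with unit costs\<close>

text \<open>
  Running times refer to a structured programming language for a random access machine: a program
  uses finitely many registers and arrays of natural numbers, addressed by name, and its only
  arithmetic operations are addition and (truncated) subtraction.  Every assignment and every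
  evaluation of a test costs one step.  Expressions are not charged by size; as a fixed program
  contains only finitely many of them, this affects running times by a constant factor only.
\<close>

datatype expr =
    Const nat
  | Reg string
  | Read string expr
  | Plus expr expr
  | Minus expr expr

datatype test =
    Less expr expr
  | Equal expr expr

datatype program =
    Skip
  | Assign string expr
  | Store string expr expr
  | Seq program program
  | Cond test program program
  | While test program

type_synonym state = "(string \<Rightarrow> nat) \<times> (string \<Rightarrow> nat \<Rightarrow> nat)"

fun eval_expr :: "expr \<Rightarrow> state \<Rightarrow> nat" where
  "eval_expr (Const k) \<sigma> = k"
| "eval_expr (Reg x) \<sigma> = fst \<sigma> x"
| "eval_expr (Read a e) \<sigma> = snd \<sigma> a (eval_expr e \<sigma>)"
| "eval_expr (Plus e1 e2) \<sigma> = eval_expr e1 \<sigma> + eval_expr e2 \<sigma>"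
| "eval_expr (Minus e1 e2) \<sigma> = eval_expr e1 \<sigma> - eval_expr e2 \<sigma>"

fun eval_test :: "test \<Rightarrow> state \<Rightarrow> bool" where
  "eval_test (Less e1 e2) \<sigma> \<longleftrightarrow> eval_expr e1 \<sigma> < eval_expr e2 \<sigma>"
| "eval_test (Equal e1 e2) \<sigma> \<longleftrightarrow> eval_expr e1 \<sigma> = eval_expr e2 \<sigma>"

text \<open>
  \<open>exec P \<sigma> t \<sigma>'\<close>: started in the state \<open>\<sigma>\<close>, the program P terminates after t steps in \<open>\<sigma>'\<close>.
\<close>

inductive exec :: "program \<Rightarrow> state \<Rightarrow> nat \<Rightarrow> state \<Rightarrow> bool" where
  Skip: "exec Skip \<sigma> 1 \<sigma>"
| Assign: "exec (Assign x e) \<sigma> 1 ((fst \<sigma>)(x := eval_expr e \<sigma>), snd \<sigma>)"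
| Store: "exec (Store a e1 e2) \<sigma> 1
    (fst \<sigma>, (snd \<sigma>)(a := (snd \<sigma> a)(eval_expr e1 \<sigma> := eval_expr e2 \<sigma>)))"
| Seq: "exec (Seq P Q) \<sigma> (t1 + t2) \<sigma>''"
    if "exec P \<sigma> t1 \<sigma>'" and "exec Q \<sigma>' t2 \<sigma>''"
| Cond_True: "exec (Cond b P Q) \<sigma> (1 + t) \<sigma>'"
    if "eval_test b \<sigma>" and "exec P \<sigma> t \<sigma>'"
| Cond_False: "exec (Cond b P Q) \<sigma> (1 + t) \<sigma>'"
    if "\<not> eval_test b \<sigma>" and "exec Q \<sigma> t \<sigma>'"
| While_False: "exec (While b P) \<sigma> 1 \<sigma>"
    if "\<not> eval_test b \<sigma>"
| While_True: "exec (While b P) \<sigma> (1 + t1 + t2) \<sigma>''"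
    if "eval_test b \<sigma>" and "exec P \<sigma> t1 \<sigma>'" and "exec (While b P) \<sigma>' t2 \<sigma>''"

inductive_cases exec_elims:
  "exec Skip \<sigma> t \<sigma>'"
  "exec (Assign x e) \<sigma> t \<sigma>'"
  "exec (Store a e1 e2) \<sigma> t \<sigma>'"
  "exec (Seq P Q) \<sigma> t \<sigma>'"
  "exec (Cond b P Q) \<sigma> t \<sigma>'"
  "exec (While b P) \<sigma> t \<sigma>'"

lemma exec_deterministic:
  "exec P \<sigma> t \<sigma>' \<Longrightarrow> exec P \<sigma> u \<sigma>'' \<Longrightarrow> u = t \<and> \<sigma>'' = \<sigma>'"
proof (induction arbitrary: u \<sigma>'' rule: exec.induct)
  case (While_True b \<sigma> P t1 \<sigma>1 t2 \<sigma>2)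
  from While_True.prems show ?case
  proof (rule exec_elims(6))
    fix s1 s2 \<tau>
    assume "u = Suc (s1 + s2)" "exec P \<sigma> s1 \<tau>" "exec (While b P) \<tau> s2 \<sigma>''"
    then show ?thesis using While_True.IH by (metis add.assoc plus_1_eq_Suc)
  qed (simp add: While_True.hyps)
qed (erule exec_elims; metis One_nat_def plus_1_eq_Suc)+

text \<open>
  The input graph is given by adjacency lists.  Its vertices are numbered by 0, ..., card V - 1,
  and \<open>\<nu>\<close> is the enumeration of the vertices.  The neighbours of the vertex i are listed, each
  once and in an arbitrary order, in the array \<open>adj\<close> at the positions from \<open>off i\<close> up to, but not
  including, \<open>off (i + 1)\<close>.  Other registers, arrays and array positions may hold arbitrary values.
\<close>

definition adjacency_lists :: "'a set \<Rightarrow> 'a set set \<Rightarrow> (nat \<Rightarrow> 'a) \<Rightarrow> state \<Rightarrow> bool" where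
  "adjacency_lists V E \<nu> \<sigma> \<longleftrightarrow>
     bij_betw \<nu> {..<card V} V \<and>
     fst \<sigma> ''n'' = card V \<and>
     snd \<sigma> ''off'' 0 = 0 \<and>
     (\<forall>i<card V.
        snd \<sigma> ''off'' i \<le> snd \<sigma> ''off'' (i + 1) \<and>
        bij_betw (snd \<sigma> ''adj'') {snd \<sigma> ''off'' i..<snd \<sigma> ''off'' (i + 1)}
          {j. j < card V \<and> {\<nu> i, \<nu> j} \<in> E})"

text \<open>
  As output, the array \<open>ord\<close> holds at the positions 0, ..., card V - 1 the vertices in the order
  of a Lex-BFS ordering.
\<close>

definition computes_lex_bfs_ordering :: "program \<Rightarrow> nat \<Rightarrow> 'a set \<Rightarrow> 'a set set \<Rightarrow> bool" where
  "computes_lex_bfs_ordering P T V E \<longleftrightarrow>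
     (\<forall>\<nu> \<sigma>. adjacency_lists V E \<nu> \<sigma> \<longrightarrow>
        (\<exists>t \<sigma>' \<phi>. exec P \<sigma> t \<sigma>' \<and> t \<le> T \<and> lex_bfs_ordering V E \<phi> \<and>
           (\<forall>i<card V. snd \<sigma>' ''ord'' i < card V \<and> \<phi> (\<nu> (snd \<sigma>' ''ord'' i)) = i + 1)))"

end

theory Submission
  imports Defs
begin

text \<open>
  Number the vertices along a Lex-BFS ordering. Every nonempty set S of vertices of an independent
  module-composed graph contains a vertex, namely the last one of S in an independent
  module-sequence, whose neighbours in S are pairwise false twins in S without that vertex. This
  excludes triangles, induced cycles of length at least five, and cycles of length six with two
  of the three pairs of opposite vertices nonadjacent. Let v be a first vertex whose earlier
  neighbours are not pairwise twins, a its first neighbour and b another one. By the four point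
  property of Lex-BFS, a and b are connected through the vertices before a, so they have a common
  neighbour q before a, as otherwise a shortest path closes to a long induced cycle through v. A
  vertex w before v that distinguishes a from b then yields, with the minimality of v and the four
  point property, a hexagon of the excluded kind.

  For the running time, an array of the vertices is kept sorted by labels, each label class being an
  interval. A neighbour of the visited vertex is swapped to the front of its class, where the moved
  vertices form a new class.
\<close>

section \<open>Elimination by twins and Lex-BFS\<close>

text \<open>The elimination is demanded in every finite vertex set, which makes it hereditary.
  Independence of the neighbours of \<open>v\<close> is included: for adjacent \<open>a\<close> and
  \<open>b\<close>, the choice \<open>w = b\<close> would give \<open>R b b\<close>.\<close>

definition twin_eliminable :: "('a \<Rightarrow> 'a \<Rightarrow> bool) \<Rightarrow> bool" where
  "twin_eliminable R \<longleftrightarrow> (\<forall>x y. R x y \<longrightarrow> R y x) \<and> (\<forall>x. \<not> R x x) \<and>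
     (\<forall>S. finite S \<longrightarrow> S \<noteq> {} \<longrightarrow>
        (\<exists>v\<in>S. \<forall>a\<in>S. \<forall>b\<in>S. \<forall>w\<in>S. w \<noteq> v \<and> R v a \<and> R v b \<and> R w a \<longrightarrow> R w b))"

text \<open>The known four point condition of Lex-BFS orderings: if \<open>c\<close> has an earlier
  neighbour \<open>a\<close> that \<open>b\<close> lacks, then \<open>b\<close> was preferred on
  account of a still earlier vertex.\<close>

definition four_point :: "('a::linorder \<Rightarrow> 'a \<Rightarrow> bool) \<Rightarrow> bool" where
  "four_point R \<longleftrightarrow>
     (\<forall>a b c. a < b \<longrightarrow> b < c \<longrightarrow> R a c \<longrightarrow> \<not> R a b \<longrightarrow> (\<exists>d<a. R d b \<and> \<not> R d c))"

section \<open>Configurations excluded by twin elimination\<close>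

context
  fixes R :: "'a::wellorder \<Rightarrow> 'a \<Rightarrow> bool"
  assumes twin: "twin_eliminable R"
begin

lemma twin_sym: "R x y \<Longrightarrow> R y x"
  using twin unfolding twin_eliminable_def by blast

lemma twin_irrefl: "\<not> R x x"
  using twin unfolding twin_eliminable_def by blast

lemma twin_elim:
  assumes "finite S" "S \<noteq> {}"
  shows "\<exists>v\<in>S. \<forall>a\<in>S. \<forall>b\<in>S. \<forall>w\<in>S. w \<noteq> v \<and> R v a \<and> R v b \<and> R w a \<longrightarrow> R w b"
  using twin assms unfolding twin_eliminable_def by blast

text \<open>Every forbidden configuration is excluded through this form: none of its vertices can be
  eliminated, because some vertex of the set tells two of its neighbours apart.\<close>

lemma no_stuck_set:
  assumes "finite S" "S \<noteq> {}"
    and "\<And>v. v \<in> S \<Longrightarrow> \<exists>a\<in>S. \<exists>b\<in>S. \<exists>w\<in>S. w \<noteq> v \<and> R v a \<and> R v b \<and> R w a \<and> \<not> R w b"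
  shows False
  using twin_elim[OF assms(1,2)] assms(3) by blast

text \<open>At each corner, the other two corners are told apart by one of themselves, which is
  adjacent to the other but not to itself.\<close>

lemma no_triangle:
  assumes "R x y" "R y z" "R x z"
  shows False
proof (rule no_stuck_set[of "{x, y, z}"])
  have sym': "R y x" "R z y" "R z x"
    using assms twin_sym by blast+
  fix u assume "u \<in> {x, y, z}"
  then consider "u = x" | "u = y" | "u = z" by blast
  then show "\<exists>a\<in>{x, y, z}. \<exists>b\<in>{x, y, z}. \<exists>w\<in>{x, y, z}. w \<noteq> u \<and> R u a \<and> R u b \<and> R w a \<and> \<not> R w b"
  proof cases
    case 1
    with assms sym' twin_irrefl show ?thesis
      by (intro bexI[of _ y] bexI[of _ z] bexI[of _ z]) auto
  next
    case 2
    with assms sym' twin_irrefl show ?thesis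
      by (intro bexI[of _ z] bexI[of _ x] bexI[of _ x]) auto
  next
    case 3
    with assms sym' twin_irrefl show ?thesis
      by (intro bexI[of _ x] bexI[of _ y] bexI[of _ y]) auto
  qed
qed auto

text \<open>The cycle is \<open>q a v b w p\<close>. The opposite pairs \<open>v\<close>,
  \<open>p\<close> and \<open>a\<close>, \<open>w\<close> are nonadjacent, while \<open>q\<close>
  and \<open>b\<close> may form a chord. At each vertex, its two neighbours on the cycle are told
  apart by an end of a nonadjacent pair.\<close>

lemma no_hexagon:
  assumes "R q a" "R a v" "R v b" "R b w" "R w p" "R p q" "\<not> R v p" "\<not> R w a"
  shows False
proof (rule no_stuck_set[of "{q, a, v, b, w, p}"])
  have sym': "R a q" "R v a" "R b v" "R w b" "R p w" "R q p" "\<not> R p v" "\<not> R a w"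
    using assms twin_sym by blast+
  fix x assume "x \<in> {q, a, v, b, w, p}"
  then consider "x = q" | "x = a" | "x = v" | "x = b" | "x = w" | "x = p" by blast
  then show "\<exists>y\<in>{q, a, v, b, w, p}. \<exists>z\<in>{q, a, v, b, w, p}. \<exists>u\<in>{q, a, v, b, w, p}.
      u \<noteq> x \<and> R x y \<and> R x z \<and> R u y \<and> \<not> R u z"
  proof cases
    case 1 with assms sym' show ?thesis by (intro bexI[of _ a] bexI[of _ p] bexI[of _ v]) auto
  next
    case 2 with assms sym' show ?thesis by (intro bexI[of _ q] bexI[of _ v] bexI[of _ p]) auto
  next
    case 3 with assms sym' show ?thesis by (intro bexI[of _ b] bexI[of _ a] bexI[of _ w]) auto
  next
    case 4 with assms sym' show ?thesis by (intro bexI[of _ v] bexI[of _ w] bexI[of _ a]) auto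
  next
    case 5 with assms sym' show ?thesis by (intro bexI[of _ b] bexI[of _ p] bexI[of _ v]) auto
  next
    case 6 with assms sym' show ?thesis by (intro bexI[of _ q] bexI[of _ w] bexI[of _ a]) auto
  qed
qed auto

text \<open>The induced path \<open>f 0, ..., f m\<close> closes through \<open>z\<close> to an
  induced cycle of length \<open>m + 2\<close>, at least five. There a vertex at distance two from
  \<open>x\<close> is adjacent to just one of the two neighbours of \<open>x\<close>.\<close>

lemma no_long_induced_cycle:
  fixes f :: "nat \<Rightarrow> 'a"
  assumes m: "3 \<le> m"
    and path: "\<And>i j. i \<le> m \<Longrightarrow> j \<le> m \<Longrightarrow> R (f i) (f j) \<longleftrightarrow> i = Suc j \<or> j = Suc i"
    and z: "\<And>i. i \<le> m \<Longrightarrow> R z (f i) \<longleftrightarrow> i = 0 \<or> i = m"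
  shows False
proof (rule no_stuck_set[of "insert z (f ` {..m})"])
  have z': "R (f i) z \<longleftrightarrow> i = 0 \<or> i = m" if "i \<le> m" for i
    using z[OF that] twin_sym by blast
  fix x assume "x \<in> insert z (f ` {..m})"
  then consider (outside) "x = z" | (inside) i where "i \<le> m" "x = f i" by auto
  then consider "x = z" | "x = f 0" | "x = f m" | i where "0 < i" "i < m" "x = f i"
  proof cases
    case outside
    then show ?thesis by (rule that(1))
  next
    case (inside i)
    then consider "i = 0" | "i = m" | "0 < i" "i < m" by linarith
    then show ?thesis using inside(2) that(2-4) by cases blast+
  qed
  then show "\<exists>y\<in>insert z (f ` {..m}). \<exists>y'\<in>insert z (f ` {..m}). \<exists>u\<in>insert z (f ` {..m}).
      u \<noteq> x \<and> R x y \<and> R x y' \<and> R u y \<and> \<not> R u y'"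
  proof cases
    case 1
    have "z \<noteq> f 1" using z[of 2] path[of 1 2] m by auto
    then show ?thesis using 1 m path[of 1 0] path[of 1 m] z[of 0] z[of m]
      by (intro bexI[of _ "f 0"] bexI[of _ "f m"] bexI[of _ "f 1"]) auto
  next
    case 2
    have "f m \<noteq> f 0" using path[of 0 1] path[of m 1] m by auto
    then show ?thesis using 2 m path[of 0 1] path[of m 1] z'[of 0] z'[of m]
      by (intro bexI[of _ z] bexI[of _ "f 1"] bexI[of _ "f m"]) auto
  next
    case 3
    have "f m \<noteq> f 0" using path[of 0 1] path[of m 1] m by auto
    then show ?thesis using 3 m path[of m "m - 1"] path[of 0 "m - 1"] z'[of 0] z'[of m]
      by (intro bexI[of _ z] bexI[of _ "f (m - 1)"] bexI[of _ "f 0"]) auto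
  next
    case i: 4
    show ?thesis
    proof (cases "Suc i = m")
      \<comment> \<open>Two steps beyond \<open>f (m - 1)\<close> the cycle has reached
        \<open>z\<close>.\<close>
      case True
      then have "R z (f (i + 1))" "\<not> R z (f (i - 1))" using z[of "i + 1"] z[of "i - 1"] i m by auto
      moreover have "i - 1 \<le> m" using i by simp
      then have "z \<noteq> f i" using z[of "i - 1"] path[of i "i - 1"] m i True by auto
      ultimately show ?thesis using i path[of i "i + 1"] path[of i "i - 1"]
        by (intro bexI[of _ "f (i + 1)"] bexI[of _ "f (i - 1)"] bexI[of _ z]) auto
    next
      case False
      moreover have "i - 1 \<le> m" using i by simp
      ultimately have "f (i + 2) \<noteq> f i" using path[of "i + 2" "i - 1"] path[of i "i - 1"] i by auto
      then show ?thesis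
        using i False path[of i "i + 1"] path[of i "i - 1"] path[of "i + 2" "i + 1"] path[of "i + 2" "i - 1"]
        by (intro bexI[of _ "f (i + 1)"] bexI[of _ "f (i - 1)"] bexI[of _ "f (i + 2)"]) auto
    qed
  qed
qed auto

text \<open>A shortest path from \<open>x\<close> to \<open>y\<close> through \<open>T\<close> is
  induced, and \<open>z\<close> is adjacent to its ends only. Length at least three would close to a
  long induced cycle, length one to a triangle; so the length is two and the middle vertex lies in
  \<open>T\<close>.\<close>

lemma common_neighbour:
  assumes "R z x" "R z y" "x \<noteq> y"
    and T: "\<And>t. t \<in> T \<Longrightarrow> \<not> R z t \<and> t \<noteq> z"
    and conn: "(x, y) \<in> {(s, t). R s t \<and> s \<in> insert x (insert y T) \<and> t \<in> insert x (insert y T)}\<^sup>*"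
  obtains t where "t \<in> T" "R t x" "R t y"
proof -
  define Q where "Q = {(s, t). R s t \<and> s \<in> insert x (insert y T) \<and> t \<in> insert x (insert y T)}"
  define m where "m = (LEAST m. (x, y) \<in> Q ^^ m)"
  have ex: "\<exists>m. (x, y) \<in> Q ^^ m" using conn rtrancl_imp_relpow unfolding Q_def by blast
  then have "(x, y) \<in> Q ^^ m" unfolding m_def by (rule LeastI_ex)
  then obtain f where f: "f 0 = x" "f m = y" "\<And>i. i < m \<Longrightarrow> (f i, f (Suc i)) \<in> Q"
    by (auto simp: relpow_fun_conv)
  have least: "m \<le> l" if "(x, y) \<in> Q ^^ l" for l using that unfolding m_def by (rule Least_le)
  have seg: "(f i, f j) \<in> Q ^^ (j - i)" if "i \<le> j" "j \<le> m" for i j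
    unfolding relpow_fun_conv using that f(3) by (intro exI[of _ "\<lambda>k. f (i + k)"]) auto
  \<comment> \<open>Replacing the segment from \<open>f i\<close> to \<open>f j\<close> by a walk of
    length \<open>l\<close> still leads from \<open>x\<close> to \<open>y\<close>, so minimality of
    \<open>m\<close> forbids shortcuts.\<close>
  have short: "j - i \<le> l" if "i \<le> j" "j \<le> m" "(f i, f j) \<in> Q ^^ l" for i j l
  proof -
    have "(f 0, f m) \<in> Q ^^ (i - 0) O Q ^^ l O Q ^^ (m - j)"
      using seg[of 0 i] seg[of j m] that by (meson order_trans relcomp.relcompI le0 order_refl)
    then have "(x, y) \<in> Q ^^ (i + (l + (m - j)))"
      using f(1,2) by (simp add: relpow_add)
    then show ?thesis using least[of "i + (l + (m - j))"] that by linarith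
  qed
  have inQ: "f i \<in> insert x (insert y T)" if "i \<le> m" for i
    using f(1) f(2) f(3)[of i] that unfolding Q_def by (cases "i = m") auto
  have adj: "R (f i) (f j) \<longleftrightarrow> j = Suc i" if "i \<le> j" "j \<le> m" for i j
  proof
    assume "R (f i) (f j)"
    then have "(f i, f j) \<in> Q ^^ 1" using inQ that unfolding Q_def by auto
    moreover have "i \<noteq> j" using \<open>R (f i) (f j)\<close> twin_irrefl by auto
    ultimately show "j = Suc i" using short[of i j 1] that by auto
  next
    assume "j = Suc i"
    then show "R (f i) (f j)" using f(3)[of i] that unfolding Q_def by auto
  qed
  have neq: "f i \<noteq> f j" if "i < j" "j \<le> m" for i j
    using short[of i j 0] that by auto
  have path: "R (f i) (f j) \<longleftrightarrow> i = Suc j \<or> j = Suc i" if "i \<le> m" "j \<le> m" for i j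
    using adj[of i j] adj[of j i] twin_sym that by (metis nat_le_linear Suc_n_not_le_n)
  have zf: "R z (f i) \<longleftrightarrow> i = 0 \<or> i = m" if "i \<le> m" for i
  proof
    assume "R z (f i)"
    then have "f i = x \<or> f i = y" using inQ[OF that] T by auto
    then show "i = 0 \<or> i = m" using neq[of 0 i] neq[of i m] f(1,2) that by fastforce
  qed (use assms(1,2) f in auto)
  have "\<not> 3 \<le> m" using no_long_induced_cycle[of m f z] path zf by blast
  moreover have "m \<noteq> 0" using f(1,2) assms(3) by (intro notI) simp
  moreover have "m \<noteq> 1" using path[of 0 1] f(1,2) no_triangle[OF assms(1) _ assms(2)] by auto
  ultimately have "m = 2" by linarith
  then have "f 1 \<in> T" "R (f 1) x" "R (f 1) y"
    using inQ[of 1] neq[of 0 1] neq[of 1 2] path[of 1 0] path[of 1 2] f(1,2)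
    by (auto simp: numeral_2_eq_2)
  then show thesis by (rule that)
qed

section \<open>Consequences of the four point property\<close>

context
  assumes four: "four_point R"
begin

lemma four_pointD: "a < b \<Longrightarrow> b < c \<Longrightarrow> R a c \<Longrightarrow> \<not> R a b \<Longrightarrow> \<exists>d<a. R d b \<and> \<not> R d c"
  using four unfolding four_point_def by blast

text \<open>If \<open>x\<close> and \<open>y\<close> are nonadjacent, the four point property gives
  \<open>d < x\<close> adjacent to \<open>y\<close>. The induction hypothesis for \<open>d\<close>,
  with \<open>x\<close> and \<open>y\<close> in the roles of \<open>y\<close> and \<open>c\<close>,
  connects \<open>d\<close> to \<open>x\<close> below \<open>x\<close>.\<close>

lemma connected_below:
  "x < y \<Longrightarrow> y < c \<Longrightarrow> R x c \<Longrightarrow> (x, y) \<in> {(s, t). R s t \<and> s \<le> y \<and> t \<le> y}\<^sup>*"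
proof (induction x arbitrary: y c rule: less_induct)
  case (less x)
  show ?case
  proof (cases "R x y")
    case True
    then show ?thesis using less.prems by (intro r_into_rtrancl) auto
  next
    case False
    then obtain d where d: "d < x" "R d y" using four_pointD less.prems by blast
    then have "(d, x) \<in> {(s, t). R s t \<and> s \<le> x \<and> t \<le> x}\<^sup>*"
      using less.IH less.prems by blast
    then have "(x, d) \<in> {(s, t). R s t \<and> s \<le> x \<and> t \<le> x}\<^sup>*"
      by (rule symD[rotated]) (intro sym_rtrancl symI, use twin_sym in auto)
    then have "(x, d) \<in> {(s, t). R s t \<and> s \<le> y \<and> t \<le> y}\<^sup>*"
      by (rule rtrancl_mono[THEN subsetD, rotated]) (use less.prems in auto)
    moreover have "(d, y) \<in> {(s, t). R s t \<and> s \<le> y \<and> t \<le> y}" using d less.prems by auto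
    ultimately show ?thesis by (rule rtrancl_into_rtrancl)
  qed
qed

text \<open>The four point property produces a walk from \<open>a\<close> to \<open>b\<close> whose
  inner vertices all precede \<open>a\<close>. None of these is adjacent to \<open>v\<close>, so
  \<open>common_neighbour\<close> applies with \<open>z = v\<close>.\<close>

lemma first_neighbour_common:
  assumes "R v a" "R v b" "a < b" "b < v" and first: "\<And>t. t < a \<Longrightarrow> \<not> R v t"
  obtains q where "q < a" "R q a" "R q b"
proof -
  have "\<not> R a b" using no_triangle assms by blast
  then obtain d where d: "d < a" "R d b" using four_pointD[of a b v] assms twin_sym by blast
  show thesis
  proof (cases "R d a")
    case True
    then show thesis using d that by blast
  next
    case False
    \<comment> \<open>The four point property is applied a second time, now to
      \<open>d < a < b\<close>; then \<open>d'\<close> is an earlier neighbour of \<open>a\<close>,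
      and \<open>connected_below\<close> joins it to \<open>d\<close>.\<close>
    then obtain d' where d': "d' < d" "R d' a" using four_pointD[of d a b] d assms by blast
    let ?Q = "{(s, t). R s t \<and> s \<in> insert a (insert b {..<a}) \<and> t \<in> insert a (insert b {..<a})}"
    have "(d', d) \<in> {(s, t). R s t \<and> s \<le> d \<and> t \<le> d}\<^sup>*"
      using connected_below d d' by blast
    then have "(d', d) \<in> ?Q\<^sup>*"
      by (rule rtrancl_mono[THEN subsetD, rotated]) (use d in auto)
    moreover have "(a, d') \<in> ?Q" "(d, b) \<in> ?Q" using d d' twin_sym by auto
    ultimately have "(a, b) \<in> ?Q\<^sup>*" by (meson converse_rtrancl_into_rtrancl rtrancl_into_rtrancl)
    then obtain t where "t \<in> {..<a}" "R t a" "R t b"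
      using assms by (elim common_neighbour[rotated 4]) auto
    then show thesis using that by auto
  qed
qed

text \<open>The core of the argument. \<open>IH\<close> expresses the minimality of
  \<open>v\<close>. The cases distinguish whether \<open>w\<close> comes before or after
  \<open>a\<close>, and which one of \<open>a\<close> and \<open>b\<close> it is adjacent
  to.\<close>

lemma first_neighbour_twin:
  assumes IH: "\<And>u a b w. u < v \<Longrightarrow> a < u \<Longrightarrow> b < u \<Longrightarrow> w < u \<Longrightarrow> R u a \<Longrightarrow> R u b \<Longrightarrow> R w a \<Longrightarrow> R w b"
    and va: "R v a" and vb: "R v b" and "a < b" "b < v" "w < v"
    and first: "\<And>t. t < a \<Longrightarrow> \<not> R v t"
  shows "R w a \<longleftrightarrow> R w b"
proof (rule ccontr)
  assume "R w a \<noteq> R w b"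
  note ord = \<open>a < b\<close> \<open>b < v\<close> \<open>w < v\<close>
  obtain q where q: "q < a" "R q a" "R q b"
    using first_neighbour_common[OF va vb \<open>a < b\<close> \<open>b < v\<close>] first by blast
  have ab: "\<not> R a b" using no_triangle va vb by blast
  have "w \<noteq> a" "w \<noteq> b" using \<open>R w a \<noteq> R w b\<close> ab twin_irrefl twin_sym by blast+
  then consider (low_b) "w < a" "R w b" "\<not> R w a" | (low_a) "w < a" "R w a" "\<not> R w b"
    | (high_b) "a < w" "R w b" "\<not> R w a" | (high_a) "a < w" "R w a" "\<not> R w b"
    using \<open>R w a \<noteq> R w b\<close> by (meson linorder_neqE)
  then show False
  proof cases
    case low_b
    \<comment> \<open>\<open>q\<close> and \<open>w\<close> are earlier neighbours of
      \<open>b\<close>, and \<open>a\<close> tells them apart, against \<open>IH\<close> at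
      \<open>b\<close>.\<close>
    then show False using IH[of b a w q] IH[of b q w a] q ord twin_sym twin_irrefl by (meson order.strict_trans)
  next
    case low_a
    have wq: "\<not> R w q" "w \<noteq> q" using no_triangle low_a q by blast+
    \<comment> \<open>The earlier of \<open>w\<close> and \<open>q\<close> is a neighbour of
      \<open>a\<close> missed by the later one, so the four point property gives a vertex before
      both adjacent to the later one. By \<open>IH\<close> at \<open>a\<close> it is adjacent to
      both. The hexagon is then \<open>a w r q b v\<close>, with chord from \<open>a\<close> to
      \<open>q\<close>.\<close>
    obtain r where r: "r < a" "R r w" "R r q"
    proof (cases "w < q")
      case True
      then obtain d where "d < w" "R d q" using four_pointD[of w q a] low_a q wq by blast
      then show thesis using IH[of a q w d] low_a q ord twin_sym that by (meson order.strict_trans)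
    next
      case False
      then obtain d where "d < q" "R d w"
        using four_pointD[of q w a] low_a q wq twin_sym by (meson linorder_neqE)
      then show thesis using IH[of a w q d] low_a q ord twin_sym that by (meson order.strict_trans)
    qed
    then have "\<not> R r v" using first twin_sym by blast
    then show False
      using no_hexagon[of a w r q b v] low_a q r va vb twin_sym by blast
  next
    case high_b
    then obtain p where p: "p < a" "R p w" using four_pointD[of a w v] va ord twin_sym by blast
    have pv: "\<not> R v p" using first p by blast
    \<comment> \<open>\<open>IH\<close> is applied at the later of \<open>b\<close> and
      \<open>w\<close>. The resulting hexagon is \<open>q a v b w p\<close>, with chord from
      \<open>q\<close> to \<open>b\<close>.\<close>
    have "R p q"
    proof (cases "b < w")
      case True
      then show ?thesis using IH[of w b p q] p q ord high_b twin_sym by (meson order.strict_trans)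
    next
      case False
      then have "w < b" using \<open>w \<noteq> b\<close> by auto
      then show ?thesis using IH[of b w q p] p q ord high_b twin_sym by (meson order.strict_trans)
    qed
    then show False
      using no_hexagon[of q a v b w p] high_b q p pv va vb twin_sym by blast
  next
    case high_a
    \<comment> \<open>If \<open>b\<close> precedes \<open>w\<close>, the four point property for
      \<open>b\<close>, \<open>w\<close>, \<open>v\<close> yields \<open>p\<close>. Otherwise it is
      used for \<open>q\<close>, \<open>w\<close>, \<open>b\<close>, and the vertex found precedes
      \<open>a\<close>, hence is not adjacent to \<open>v\<close>.\<close>
    obtain p where p: "p < w" "R p w" "\<not> R p v"
    proof (cases "b < w")
      case True
      then obtain d where "d < b" "R d w" "\<not> R d v" using four_pointD[of b w v] vb ord high_a twin_sym by blast
      then show thesis using that True by (meson order.strict_trans)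
    next
      case False
      then have wb: "w < b" using \<open>w \<noteq> b\<close> by auto
      have "\<not> R q w" using no_triangle q high_a by blast
      then obtain d where "d < q" "R d w" 
        using four_pointD[of q w b] q wb high_a by (meson order.strict_trans)
      then show thesis using that first q high_a twin_sym by (meson order.strict_trans)
    qed
    then have "R q p"
      using IH[of w a p q] q ord high_a twin_sym by (meson order.strict_trans)
    then show False
      using no_hexagon[of q b v a w p] high_a q p va vb twin_sym by blast
  qed
qed

text \<open>Strong induction supplies the minimality of \<open>v\<close>; two arbitrary earlier
  neighbours are both compared with the first one.\<close>

theorem neighbours_twins:
  "a < v \<Longrightarrow> b < v \<Longrightarrow> w < v \<Longrightarrow> R v a \<Longrightarrow> R v b \<Longrightarrow> R w a \<Longrightarrow> R w b"
proof (induction v arbitrary: a b w rule: less_induct)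
  case (less v)
  define f where "f = (LEAST t. R v t)"
  have f: "R v f" "f \<le> a" "f \<le> b"
    unfolding f_def using less.prems by (auto intro: LeastI Least_le)
  have first: "\<not> R v t" if "t < f" for t using that not_less_Least unfolding f_def by blast
  have "R w f \<longleftrightarrow> R w x" if "R v x" "x < v" "f \<le> x" for x
  proof (cases "f = x")
    case False
    then have "f < x" using that by simp
    show ?thesis
    proof (rule first_neighbour_twin[of v f x w])
      fix u a b w
      assume "u < v" "a < u" "b < u" "w < u" "R u a" "R u b" "R w a"
      then show "R w b" by (rule less.IH)
    qed (fact f(1) that(1,2) first \<open>w < v\<close> \<open>f < x\<close>)+
  qed simp
  then show ?case using less.prems f by blast
qed

end

end

section \<open>Labels of Lex-BFS and the four point property\<close>

text \<open>At the first difference \<open>L\<close> has the larger entry. As the lists decrease,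
  this entry is missing from \<open>M\<close>, and \<open>x\<close> can only occur in
  \<open>M\<close> at or after that position.\<close>

lemma decreasing_not_lexord:
  fixes L M :: "nat list"
  assumes "sorted_wrt (>) L" "sorted_wrt (>) M" "(L, M) \<notin> lexord less_than" "x \<in> set M" "x \<notin> set L"
  shows "\<exists>y\<in>set L. x < y \<and> y \<notin> set M"
  using assms
proof (induction L M rule: list_induct2')
  case (4 l L m M)
  consider "l < m" | "l = m" | "m < l" by linarith
  then show ?case
  proof cases
    case 1
    then show ?thesis using 4 by simp
  next
    case 2
    then obtain y where "y \<in> set L" "x < y" "y \<notin> set M"
      using 4 by auto
    moreover have "y \<noteq> m" using 4 2 calculation(1) by auto
    ultimately show ?thesis by auto
  next
    case 3
    then have "l \<notin> set (m # M)" "x < l" using 4 by fastforce+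
    then show ?thesis by auto
  qed
qed auto

lemma lex_bfs_run_labels:
  assumes "lex_bfs_run V E vs lab" "finite V"
  shows "distinct vs \<and> set vs \<subseteq> V \<and>
    (\<forall>w\<in>V - set vs. sorted_wrt (>) (lab w) \<and>
       set (lab w) = (\<lambda>j. card V - j) ` {j. j < length vs \<and> {vs ! j, w} \<in> E})"
  using assms
proof (induction rule: lex_bfs_run.induct)
  case (visit vs lab v)
  let ?lab = "\<lambda>w. if w \<in> neighbours V E v - set vs then lab w @ [card V - length vs] else lab w"
  have IH: "distinct vs" "set vs \<subseteq> V" using visit by auto
  have "card (insert v (set vs)) \<le> card V"
    using visit by (intro card_mono) auto
  then have len: "length vs < card V" using IH visit by (simp add: distinct_card)
  have "sorted_wrt (>) (?lab w) \<and> set (?lab w) =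
      (\<lambda>j. card V - j) ` {j. j < length (vs @ [v]) \<and> {(vs @ [v]) ! j, w} \<in> E}"
    if w: "w \<in> V - set (vs @ [v])" for w
  proof -
    have IHw: "sorted_wrt (>) (lab w)"
        "set (lab w) = (\<lambda>j. card V - j) ` {j. j < length vs \<and> {vs ! j, w} \<in> E}"
      using visit w by auto
    have "{j. j < length (vs @ [v]) \<and> {(vs @ [v]) ! j, w} \<in> E} =
        {j. j < length vs \<and> {vs ! j, w} \<in> E} \<union> (if {v, w} \<in> E then {length vs} else {})"
      by (auto simp: nth_append less_Suc_eq)
    \<comment> \<open>Fewer than \<open>card V\<close> vertices have been visited, so truncated
      subtraction is strictly decreasing here and the appended number is the smallest.\<close>
    moreover have "card V - length vs < x" if "x \<in> set (lab w)" for x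
      using that len unfolding IHw(2) by auto
    ultimately show ?thesis
      using IHw w by (auto simp: neighbours_def sorted_wrt_append)
  qed
  then show ?case using IH visit by auto
qed auto

text \<open>\<open>w\<close> is any vertex unvisited when \<open>vs ! b\<close> was chosen, so only
  the step that visits \<open>vs ! b\<close> matters. The label of \<open>w\<close> then contains
  the number of \<open>vs ! a\<close>, that of \<open>vs ! b\<close> does not; maximality forces a
  larger number in the label of \<open>vs ! b\<close> alone, which comes from an earlier
  \<open>d\<close>.\<close>

lemma lex_bfs_run_four_point:
  assumes "lex_bfs_run V E vs lab" "finite V" "a < b" "b < length vs" "w \<in> V - set (take b vs)"
    and "{vs ! a, w} \<in> E" "{vs ! a, vs ! b} \<notin> E"
  shows "\<exists>d<a. {vs ! d, vs ! b} \<in> E \<and> {vs ! d, w} \<notin> E"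
  using assms
proof (induction rule: lex_bfs_run.induct)
  case (visit vs lab v)
  show ?case
  proof (cases "b = length vs")
    case False
    then show ?thesis using visit by (auto simp: nth_append)
  next
    case True
    note labels = lex_bfs_run_labels[OF visit.hyps(1) visit.prems(1)]
    have w: "w \<in> V - set vs" and v: "v \<in> V - set vs" using visit True by auto
    have "card (insert v (set vs)) \<le> card V"
      using visit labels by (intro card_mono) auto
    then have len: "length vs < card V" using labels v by (simp add: distinct_card)
    have a: "a < length vs" "{vs ! a, w} \<in> E" "{vs ! a, v} \<notin> E"
      using visit.prems True by (auto simp: nth_append)
    have lab: "card V - j \<in> set (lab u) \<longleftrightarrow> {vs ! j, u} \<in> E" if "u \<in> V - set vs" "j < length vs" for u j
    proof -
      have "set (lab u) = (\<lambda>j. card V - j) ` {j. j < length vs \<and> {vs ! j, u} \<in> E}"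
        using labels that by blast
      moreover have "j = j'" if "card V - j = card V - j'" "j' < length vs" for j'
        using that \<open>j < length vs\<close> len by linarith
      ultimately show ?thesis using that by auto
    qed
    have "\<exists>y\<in>set (lab v). card V - a < y \<and> y \<notin> set (lab w)"
      using decreasing_not_lexord[of "lab v" "lab w" "card V - a"] labels lab a v w visit.hyps(3) by blast
    then obtain d where "d < length vs" "{vs ! d, v} \<in> E" "card V - a < card V - d"
        "card V - d \<notin> set (lab w)"
      using labels v by auto
    then show ?thesis using lab[OF w] a True by (intro exI[of _ d]) (auto simp: nth_append)
  qed
qed simp

section \<open>From independent module-composed graphs to relations on numbers, and back\<close>

theorem lex_bfs_ordering_independent_module_sequence:
  fixes V :: "'a set"
  assumes G: "simple_graph V E" and "independent_module_composed V E" and lex: "lex_bfs_ordering V E \<phi>"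
  shows "independent_module_sequence V E \<phi>"
proof -
  define n where "n = card V"
  define f where "f = inv_into V \<phi>"
  have fin: "finite V" using G by (simp add: simple_graph_def)
  have bij: "bij_betw \<phi> V {1..n}" using lex unfolding lex_bfs_ordering_def n_def by blast
  have bij_f: "bij_betw f {1..n} V" unfolding f_def by (rule bij_betw_inv_into[OF bij])
  have inj_f: "f i = f j \<longleftrightarrow> i = j" if "i \<in> {1..n}" "j \<in> {1..n}" for i j
    using inj_on_eq_iff[OF bij_betw_imp_inj_on[OF bij_f]] that by blast
  have f_V: "f i \<in> V" if "i \<in> {1..n}" for i
    using bij_betwE[OF bij_f] that by blast
  obtain \<psi> where \<psi>: "independent_module_sequence V E \<psi>"
    using assms unfolding independent_module_composed_def by blast
  then have bij_\<psi>: "bij_betw \<psi> V {1..n}" unfolding independent_module_sequence_def n_def by blast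
  \<comment> \<open>Adjacency is pulled back to the numbers of the visits, so that \<open><\<close>
    is the search order; numbers outside \<open>{1..n}\<close> are isolated.\<close>
  define R where "R i j \<longleftrightarrow> i \<in> {1..n} \<and> j \<in> {1..n} \<and> {f i, f j} \<in> E" for i j
  have irrefl_R: "\<not> R x x" for x
  proof
    assume "R x x"
    then have "card {f x, f x} = 2" using G unfolding R_def simple_graph_def by blast
    then show False by simp
  qed
  have twin: "twin_eliminable R"
    unfolding twin_eliminable_def
  proof (intro conjI allI impI)
    show "R y x" if "R x y" for x y using that by (auto simp: R_def insert_commute)
    show "\<not> R x x" for x by (rule irrefl_R)
  next
    fix S :: "nat set"
    assume S: "finite S" "S \<noteq> {}"
    show "\<exists>v\<in>S. \<forall>a\<in>S. \<forall>b\<in>S. \<forall>w\<in>S. w \<noteq> v \<and> R v a \<and> R v b \<and> R w a \<longrightarrow> R w b"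
    proof (cases "S \<inter> {1..n} = {}")
      case True
      then show ?thesis using S unfolding R_def by blast
    next
      case False
      define h where "h v = \<psi> (f v)" for v
      have bij_h: "bij_betw h {1..n} {1..n}"
        using bij_betw_trans[OF bij_f bij_\<psi>] unfolding h_def comp_def .
      \<comment> \<open>\<open>h\<close> gives the place in the sequence \<open>\<psi>\<close> of
        the vertex with a given visit number; the vertex to eliminate is the last one of
        \<open>S\<close> with respect to \<open>\<psi>\<close>.\<close>
      have "Max (h ` (S \<inter> {1..n})) \<in> h ` (S \<inter> {1..n})"
        using False by (intro Max_in) auto
      then obtain v where v: "v \<in> S" "v \<in> {1..n}" "h v = Max (h ` (S \<inter> {1..n}))" by auto
      define U where "U = inv_into V \<psi> ` {1..h v - 1}"
      have in_U: "f u \<in> U \<and> 2 \<le> h v" if "u \<in> S" "u \<in> {1..n}" "u \<noteq> v" for u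
      proof -
        have "h u \<le> h v" unfolding v(3) using that by (intro Max_ge) auto
        moreover have "h u \<noteq> h v" 
          using inj_on_eq_iff[OF bij_betw_imp_inj_on[OF bij_h]] v that by blast
        moreover have "h u \<in> {1..n}" using bij_betwE[OF bij_h] that by blast
        moreover have "inv_into V \<psi> (h u) = f u"
          unfolding h_def using bij_\<psi> f_V that by (simp add: bij_betw_inv_into_left)
        ultimately show ?thesis unfolding U_def by (auto intro!: image_eqI[of _ _ "h u"])
      qed
      define N where "N = neighbours V E (f v) \<inter> U"
      have "h v \<in> {1..n}" using bij_betwE[OF bij_h] v by blast
      moreover have "inv_into V \<psi> (h v) = f v"
        unfolding h_def using bij_\<psi> f_V v by (simp add: bij_betw_inv_into_left)
      \<comment> \<open>The sequence constrains places from 2 on only; \<open>2 \<le> h v\<close>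
        follows as soon as \<open>S\<close> contains another vertex.\<close>
      ultimately have N: "is_module U (induced_edges E U) N" "independent_set U (induced_edges E U) N"
        if "2 \<le> h v"
        using that bspec[OF conjunct2[OF \<psi>[unfolded independent_module_sequence_def Let_def]], of "h v"]
        by (simp_all add: N_def U_def n_def)
      show ?thesis
      proof (intro bexI[OF _ v(1)] ballI impI, elim conjE)
        fix a b w assume "a \<in> S" "b \<in> S" "w \<in> S" "w \<noteq> v" "R v a" "R v b" "R w a"
        moreover have "a \<noteq> v" "b \<noteq> v" using calculation irrefl_R by blast+
        ultimately have *: "f a \<in> U" "f b \<in> U" "f w \<in> U" "2 \<le> h v"
          using in_U unfolding R_def by blast+
        have ab: "f a \<in> N" "f b \<in> N"
          using * \<open>R v a\<close> \<open>R v b\<close> f_V unfolding N_def neighbours_def R_def by auto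
        have wa: "{f w, f a} \<in> induced_edges E U"
          using * \<open>R w a\<close> unfolding induced_edges_def R_def by auto
        \<comment> \<open>Independence keeps \<open>f w\<close>, a neighbour of \<open>f a\<close>,
          outside \<open>N\<close>; only therefore does the module property carry it over to
          \<open>f b\<close>.\<close>
        then have "f w \<notin> N" using N(2) ab * unfolding independent_set_def by blast
        moreover have "f w \<in> neighbours U (induced_edges E U) (f a)"
          using * wa by (auto simp: neighbours_def insert_commute)
        ultimately have "f w \<in> neighbours U (induced_edges E U) (f b)"
          using N(1) ab * unfolding is_module_def by blast
        then show "R w b"
          using \<open>R v b\<close> \<open>R w a\<close> by (auto simp: neighbours_def induced_edges_def R_def insert_commute)
      qed
    qed
  qed
  have four: "four_point R"
    unfolding four_point_def
  proof (intro allI impI)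
    fix a b c assume abc: "a < b" "b < c" "R a c" "\<not> R a b"
    define vs where "vs = map f [1..<Suc n]"
    have vs: "length vs = n" "\<And>i. i < n \<Longrightarrow> vs ! i = f (Suc i)"
      unfolding vs_def by (auto simp del: upt_Suc)
    obtain lab where run: "lex_bfs_run V E vs lab"
      using lex unfolding lex_bfs_ordering_def vs_def f_def n_def by blast
    have c: "0 < a" "c \<le> n" using abc by (auto simp: R_def)
    \<comment> \<open>List positions are visit numbers less one.\<close>
    have "f c \<notin> set (take (b - 1) vs)"
      using inj_f abc c by (auto simp: in_set_conv_nth vs)
    then have "\<exists>d<a - 1. {vs ! d, vs ! (b - 1)} \<in> E \<and> {vs ! d, f c} \<notin> E"
      using abc c f_V fin by (intro lex_bfs_run_four_point[OF run]) (auto simp: vs R_def)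
    then obtain d where "d < a - 1" "{f (Suc d), f b} \<in> E" "{f (Suc d), f c} \<notin> E"
      using abc c vs by auto
    then show "\<exists>d<a. R d b \<and> \<not> R d c"
      using abc c by (intro exI[of _ "Suc d"]) (auto simp: R_def)
  qed
  have "is_module U (induced_edges E U) N \<and> independent_set U (induced_edges E U) N"
    if i: "i \<in> {2..n}" and U: "U = f ` {1..i - 1}" and N: "N = neighbours V E (f i) \<inter> U" for i U N
  proof -
    have N_R: "\<exists>a. x = f a \<and> a < i \<and> R i a" if x: "x \<in> N" for x
    proof -
      obtain a where "x = f a" "a \<in> {1..i - 1}" using x unfolding N U by blast
      then show ?thesis
        using x i unfolding N neighbours_def R_def by (intro exI[of _ a]) auto
    qed
    have U_R: "\<exists>w. y = f w \<and> w < i \<and> R w a" if y: "y \<in> U" and "{f a, y} \<in> E" "a < i" "R i a" for y a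
    proof -
      obtain w where "y = f w" "w \<in> {1..i - 1}" using y unfolding U by blast
      then show ?thesis
        using that i unfolding R_def by (intro exI[of _ w]) (auto simp: insert_commute)
    qed
    \<comment> \<open>By \<open>neighbours_twins\<close> the members of \<open>N\<close> have equal
      neighbourhoods in \<open>U\<close>, which gives the module property;
      \<open>no_triangle\<close> gives independence.\<close>
    have "y \<in> neighbours U (induced_edges E U) x'"
      if N: "x \<in> N" "x' \<in> N" and y: "y \<in> neighbours U (induced_edges E U) x" for x x' y
    proof -
      obtain a b where ab: "x = f a" "x' = f b" "a < i" "b < i" "R i a" "R i b"
        using N_R[OF N(1)] N_R[OF N(2)] by blast
      obtain w where w: "y = f w" "w < i" "R w a"
        using U_R[of y a] y ab by (auto simp: neighbours_def induced_edges_def)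
      then have "R w b" using neighbours_twins[OF twin four, of a i b w] ab by blast
      then show ?thesis
        using that w ab unfolding neighbours_def induced_edges_def R_def U by (auto simp: insert_commute)
    qed
    moreover have "{x, y} \<notin> E" if N: "x \<in> N" "y \<in> N" for x y
    proof
      assume "{x, y} \<in> E"
      moreover obtain a b where "x = f a" "y = f b" and ab: "R i a" "R i b"
        using N_R[OF N(1)] N_R[OF N(2)] by blast
      ultimately have "R a b" unfolding R_def by simp
      then show False using no_triangle[OF twin, of i a b] ab by blast
    qed
    moreover have "N \<subseteq> U" using N by auto
    ultimately show ?thesis
      unfolding is_module_def independent_set_def induced_edges_def by blast
  qed
  then show ?thesis
    using bij unfolding independent_module_sequence_def f_def n_def Let_def by auto
qed

section \<open>Partition refinement\<close>

lemma lexord_snoc_left: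
  fixes L N :: "nat list"
  assumes "(L, N) \<notin> lexord less_than"
  shows "(L @ [k], N) \<notin> lexord less_than"
  using assms lexord_trans[of L "L @ [k]" less_than N] lexord_append_rightI[of "[k]" L less_than]
  by (auto simp: trans_less_than)

text \<open>If \<open>L\<close> is a proper prefix of \<open>M\<close>, the next entry of
  \<open>M\<close> is at least \<open>k\<close>; otherwise an earlier difference already
  decides.\<close>

lemma lexord_snoc_right:
  fixes L M :: "nat list"
  assumes "(M, L) \<notin> lexord less_than" "M \<noteq> L" "\<forall>x\<in>set M. k \<le> x"
  shows "(M, L @ [k]) \<notin> lexord less_than"
  using assms
proof (induction M L rule: list_induct2')
  case (2 x M)
  then show ?case by (simp add: not_less)
next
  case (4 x M y L)
  then show ?case by (cases "x = y") simp_all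
qed simp_all

text \<open>
  The positions from b on hold the unvisited vertices, sorted by decreasing labels. The array
  \<open>cell\<close> maps positions to identifiers of label classes, and LB recovers the label of a class
  from its identifier.
\<close>

definition refinement ::
  "nat \<Rightarrow> nat \<Rightarrow> (nat \<Rightarrow> nat list) \<Rightarrow> (nat \<Rightarrow> nat) \<Rightarrow> (nat \<Rightarrow> nat) \<Rightarrow> (nat \<Rightarrow> nat) \<Rightarrow> (nat \<Rightarrow> nat) \<Rightarrow>
    nat \<Rightarrow> (nat \<Rightarrow> nat list) \<Rightarrow> bool" where
  "refinement n b lab ord pos cell start K LB \<longleftrightarrow>
     (\<forall>j<n. ord j < n \<and> pos (ord j) = j) \<and> (\<forall>x<n. pos x < n \<and> ord (pos x) = x) \<and>
     inj_on LB {..<K} \<and>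
     (\<forall>j. b \<le> j \<and> j < n \<longrightarrow>
        cell j < K \<and> LB (cell j) = lab (ord j) \<and> b \<le> start (cell j) \<and> start (cell j) \<le> j \<and>
        cell ` {start (cell j)..j} \<subseteq> {cell j}) \<and>
     (\<forall>j j'. b \<le> j \<and> j \<le> j' \<and> j' < n \<longrightarrow> (lab (ord j), lab (ord j')) \<notin> lexord less_than)"

text \<open>
  While the number k is handed out, the class c keeps the vertices that have not received it, and
  \<open>new c\<close> collects those that have; \<open>stamp c = b\<close> indicates that \<open>new c\<close> exists already.
\<close>

definition splitting ::
  "nat \<Rightarrow> nat \<Rightarrow> nat \<Rightarrow> (nat \<Rightarrow> nat list) \<Rightarrow> (nat \<Rightarrow> nat) \<Rightarrow> (nat \<Rightarrow> nat) \<Rightarrow> (nat \<Rightarrow> nat) \<Rightarrow>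
    (nat \<Rightarrow> nat) \<Rightarrow> (nat \<Rightarrow> nat) \<Rightarrow> (nat \<Rightarrow> nat) \<Rightarrow> nat \<Rightarrow> (nat \<Rightarrow> nat list) \<Rightarrow> bool" where
  "splitting n b k lab ord pos cell start new stamp K LB \<longleftrightarrow>
     refinement n b lab ord pos cell start K LB \<and>
     (\<forall>c<K. stamp c \<le> b \<and> set (LB c) \<subseteq> {k..} \<and>
        (k \<notin> set (LB c) \<longrightarrow>
          (if stamp c = b
           then new c < K \<and> LB (new c) = LB c @ [k] \<and> b \<le> start (new c) \<and> start (new c) \<le> start c \<and>
             cell ` {start (new c)..<start c} \<subseteq> {new c}
           else LB c @ [k] \<notin> LB ` {..<K})))"

lemma refinementD:
  assumes "refinement n b lab ord pos cell start K LB"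
  shows "j < n \<Longrightarrow> ord j < n" "j < n \<Longrightarrow> pos (ord j) = j"
    and "x < n \<Longrightarrow> pos x < n" "x < n \<Longrightarrow> ord (pos x) = x"
    and "inj_on LB {..<K}"
    and "b \<le> j \<Longrightarrow> j < n \<Longrightarrow> cell j < K"
    and "b \<le> j \<Longrightarrow> j < n \<Longrightarrow> LB (cell j) = lab (ord j)"
    and "b \<le> j \<Longrightarrow> j < n \<Longrightarrow> b \<le> start (cell j)"
    and "b \<le> j \<Longrightarrow> j < n \<Longrightarrow> start (cell j) \<le> j"
    and "b \<le> j \<Longrightarrow> j < n \<Longrightarrow> start (cell j) \<le> j' \<Longrightarrow> j' \<le> j \<Longrightarrow> cell j' = cell j"
    and "b \<le> j \<Longrightarrow> j \<le> j' \<Longrightarrow> j' < n \<Longrightarrow> (lab (ord j), lab (ord j')) \<notin> lexord less_than"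
proof -
  note ref = assms[unfolded refinement_def]
  show "j < n \<Longrightarrow> ord j < n" "j < n \<Longrightarrow> pos (ord j) = j" "x < n \<Longrightarrow> pos x < n" "x < n \<Longrightarrow> ord (pos x) = x"
    "inj_on LB {..<K}" "b \<le> j \<Longrightarrow> j < n \<Longrightarrow> cell j < K" "b \<le> j \<Longrightarrow> j < n \<Longrightarrow> LB (cell j) = lab (ord j)"
    "b \<le> j \<Longrightarrow> j < n \<Longrightarrow> b \<le> start (cell j)" "b \<le> j \<Longrightarrow> j < n \<Longrightarrow> start (cell j) \<le> j"
    using ref by simp_all
  show "b \<le> j \<Longrightarrow> j < n \<Longrightarrow> start (cell j) \<le> j' \<Longrightarrow> j' \<le> j \<Longrightarrow> cell j' = cell j"
    using ref by (meson atLeastAtMost_iff image_subset_iff singletonD)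
  show "b \<le> j \<Longrightarrow> j \<le> j' \<Longrightarrow> j' < n \<Longrightarrow> (lab (ord j), lab (ord j')) \<notin> lexord less_than"
    using ref by simp
qed

lemma splittingD:
  assumes "splitting n b k lab ord pos cell start new stamp K LB"
  shows "refinement n b lab ord pos cell start K LB"
    and "d < K \<Longrightarrow> stamp d \<le> b \<and> set (LB d) \<subseteq> {k..}"
    and "d < K \<Longrightarrow> k \<notin> set (LB d) \<Longrightarrow> stamp d = b \<Longrightarrow>
      new d < K \<and> LB (new d) = LB d @ [k] \<and> b \<le> start (new d) \<and> start (new d) \<le> start d \<and>
      cell ` {start (new d)..<start d} \<subseteq> {new d}"
    and "d < K \<Longrightarrow> k \<notin> set (LB d) \<Longrightarrow> stamp d \<noteq> b \<Longrightarrow> LB d @ [k] \<notin> LB ` {..<K}"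
proof -
  note spl = assms[unfolded splitting_def]
  show "refinement n b lab ord pos cell start K LB" using spl by (rule conjunct1)
  show "d < K \<Longrightarrow> stamp d \<le> b \<and> set (LB d) \<subseteq> {k..}" using spl by blast
  assume "d < K" "k \<notin> set (LB d)"
  then have *: "if stamp d = b
    then new d < K \<and> LB (new d) = LB d @ [k] \<and> b \<le> start (new d) \<and> start (new d) \<le> start d \<and>
      cell ` {start (new d)..<start d} \<subseteq> {new d}
    else LB d @ [k] \<notin> LB ` {..<K}"
    using spl by blast
  show "stamp d = b \<Longrightarrow>
      new d < K \<and> LB (new d) = LB d @ [k] \<and> b \<le> start (new d) \<and> start (new d) \<le> start d \<and>
      cell ` {start (new d)..<start d} \<subseteq> {new d}"
    using * by (simp only: if_True)
  show "stamp d \<noteq> b \<Longrightarrow> LB d @ [k] \<notin> LB ` {..<K}"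
    using * by simp
qed

section \<open>Preservation of the label classes during a visit\<close>

text \<open>The visited position \<open>i\<close> is the front of its class, so advancing
  \<open>start\<close> past it removes it. No stamp equals \<open>Suc i\<close> and no label
  contains \<open>k\<close>, hence no class has been split yet.\<close>

lemma splitting_start:
  assumes ref: "refinement n i lab ord pos cell start K LB" and "i < n"
    and fresh: "\<And>c. c < K \<Longrightarrow> stamp c \<le> i \<and> set (LB c) \<subseteq> {k<..}"
  shows "splitting n (Suc i) k lab ord pos cell (start(cell i := Suc i)) new stamp K LB"
proof -
  note r = refinementD[OF ref]
  have si: "start (cell i) = i" using r(8)[of i] r(9)[of i] \<open>i < n\<close> by simp
  \<comment> \<open>A class with a position beyond \<open>i\<close> that starts at or before
    \<open>i\<close> would contain \<open>i\<close>.\<close>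
  have later: "Suc i \<le> start (cell j)" if "Suc i \<le> j" "j < n" "cell j \<noteq> cell i" for j
    using r(8)[of j] r(10)[of j i] that by (metis Suc_leD Suc_leI le_neq_implies_less order_refl)
  have "cell ` {(start(cell i := Suc i)) (cell j)..j} \<subseteq> {cell j}" if j: "Suc i \<le> j" "j < n" for j
  proof (rule image_subsetI)
    fix x assume "x \<in> {(start(cell i := Suc i)) (cell j)..j}"
    then have "cell x = cell j" using r(10)[of j x] j si by (auto split: if_splits)
    then show "cell x \<in> {cell j}" by simp
  qed
  then have "refinement n (Suc i) lab ord pos cell (start(cell i := Suc i)) K LB"
    using r(1-9,11) later unfolding refinement_def by simp
  moreover have "LB c @ [k] \<notin> LB ` {..<K}" if "c < K" for c
  proof
    assume "LB c @ [k] \<in> LB ` {..<K}"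
    then obtain d where "d < K" "LB d = LB c @ [k]" by auto
    then have "k \<in> set (LB d)" by simp
    then show False using fresh[OF \<open>d < K\<close>] by auto
  qed
  moreover have "stamp c \<le> Suc i" "stamp c \<noteq> Suc i" "set (LB c) \<subseteq> {k..}" if "c < K" for c
    using fresh[OF that] by auto
  ultimately show ?thesis unfolding splitting_def by simp
qed

text \<open>The new class \<open>K\<close> begins as an empty interval directly before the remaining
  part of \<open>c\<close>. Its label is not yet taken, so \<open>LB\<close> stays injective.
  Writing 0 to \<open>stamp K\<close> overwrites an arbitrary old value.\<close>

lemma splitting_new_class:
  assumes spl: "splitting n b k lab ord pos cell start new stamp K LB"
    and c: "c < K" "k \<notin> set (LB c)" "stamp c \<noteq> b" "b \<le> start c"
  shows "splitting n b k lab ord pos cell (start(K := start c)) (new(c := K)) (stamp(K := 0, c := b))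
    (Suc K) (LB(K := LB c @ [k]))"
proof -
  note s = splittingD(2)[OF spl] and s1 = splittingD(3)[OF spl] and s2 = splittingD(4)[OF spl]
  note ref = splittingD(1)[OF spl]
  note r = refinementD[OF ref]
  have "inj_on (LB(K := LB c @ [k])) {..<Suc K}"
    using inj_on_fun_updI[OF r(5) s2[OF c(1-3)]] s2[OF c(1-3)] unfolding lessThan_Suc by auto
  then have "refinement n b lab ord pos cell (start(K := start c)) (Suc K) (LB(K := LB c @ [k]))"
    using ref unfolding refinement_def by (auto simp: less_Suc_eq)
  moreover have "LB d @ [k] \<notin> (LB(K := LB c @ [k])) ` {..<Suc K}"
    if "d < K" "k \<notin> set (LB d)" "stamp d \<noteq> b" "d \<noteq> c" for d
  proof -
    have "LB d \<noteq> LB c" using inj_onD[OF r(5), of d c] that c by auto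
    then show ?thesis using s2[OF that(1-3)] unfolding lessThan_Suc by auto
  qed
  ultimately show ?thesis
    unfolding splitting_def
  proof (intro conjI allI impI, goal_cases)
    case (2 d)
    then show ?case using s[of d] by (cases "d = K") auto
  next
    case (3 d)
    then show ?case using s[of d] s[of c] c by (cases "d = K") auto
  next
    case (4 d)
    then have d: "d < K" "k \<notin> set (LB d)" by (auto split: if_splits)
    show ?case
    proof (cases "d = c")
      case True
      then show ?thesis using c by auto
    next
      case False
      then show ?thesis using d 4 s1[OF d] by auto
    qed
  qed
qed

text \<open>\<open>w\<close> changes places with the vertex at the front \<open>s\<close> of its
  class. Then \<open>s\<close> passes from the left end of \<open>c\<close> to the right end of
  \<open>new c\<close>, and both remain intervals.\<close>

lemma splitting_move:
  assumes spl: "splitting n b k lab ord pos cell start new stamp K LB"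
    and p: "b \<le> p" "p < n" and w: "w = ord p" and c: "c = cell p" "k \<notin> set (LB c)" "stamp c = b"
    and s: "s = start c"
  shows "splitting n b k (lab(w := lab w @ [k])) (ord(p := ord s, s := w)) (pos(ord s := p, w := s))
    (cell(s := new c)) (start(c := Suc s)) new stamp K LB"
proof -
  note spl1 = splittingD(2)[OF spl] and new = splittingD(3)[OF spl] and spl2 = splittingD(4)[OF spl]
  note ref = splittingD(1)[OF spl]
  note r = refinementD[OF ref]
  have cK: "c < K" and sp: "b \<le> s" "s \<le> p" "s < n" and cs: "cell s = c"
    using r(6,8,9)[of p] r(10)[of p s] p c s by auto
  note new_c = new[OF cK c(2,3)]
  \<comment> \<open>The label of \<open>new d\<close> contains \<open>k\<close>, that of
    \<open>c\<close> does not.\<close>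
  have unclean: "new d \<noteq> c" if "d < K" "k \<notin> set (LB d)" "stamp d = b" for d
    using new[OF that] c(2) by auto
  have pw: "pos w = p" "w < n" and ps: "pos (ord s) = s" "ord s < n"
    using r(1,2) p sp w by auto
  define ord' where "ord' = ord(p := ord s, s := w)"
  define pos' where "pos' = pos(ord s := p, w := s)"
  define cell' where "cell' = cell(s := new c)"
  define start' where "start' = start(c := Suc s)"
  define lab' where "lab' = lab(w := lab w @ [k])"
  have perm: "ord' j < n \<and> pos' (ord' j) = j" if "j < n" for j
    using r(1,2) that p sp w unfolding ord'_def pos'_def by (metis fun_upd_apply)
  have perm': "pos' x < n \<and> ord' (pos' x) = x" if "x < n" for x
    using r(3,4) that p sp w pw ps unfolding ord'_def pos'_def by (metis fun_upd_apply)
  \<comment> \<open>The two swapped vertices shared the label \<open>LB c\<close>, so viewed by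
    position the labels change at \<open>s\<close> only.\<close>
  have lab_j: "lab' (ord' j) = (if j = s then LB c @ [k] else lab (ord j))" if "b \<le> j" "j < n" for j
  proof -
    have "lab w = LB c" "lab (ord s) = LB c" using r(7)[of p] r(7)[of s] p c w sp cs by auto
    moreover have "ord j = w \<longleftrightarrow> j = p" using r(2) that pw p w by metis
    moreover have "ord s = w \<longleftrightarrow> s = p" using pw ps w by metis
    ultimately show ?thesis unfolding lab'_def ord'_def w[symmetric] by (auto simp: w[symmetric])
  qed
  have cells: "cell' j < K \<and> LB (cell' j) = lab' (ord' j) \<and> b \<le> start' (cell' j) \<and> start' (cell' j) \<le> j \<and>
      cell' ` {start' (cell' j)..j} \<subseteq> {cell' j}" if j: "b \<le> j" "j < n" for j
  proof (cases "j = s")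
    case True
    have "cell' x = new c" if "start (new c) \<le> x" "x \<le> s" for x
    proof (cases "x = s")
      case False
      then have "x \<in> {start (new c)..<start c}" using that s by simp
      then show ?thesis using new_c False unfolding cell'_def by (simp add: image_subset_iff)
    qed (simp add: cell'_def)
    then show ?thesis
      using True new_c unclean[OF cK c(2,3)] lab_j[OF j] s unfolding cell'_def start'_def
      by (simp add: image_subset_iff)
  next
    case js: False
    show ?thesis
    proof (cases "cell j = c")
      case True
      have "s < j" using r(9)[OF j] js True s by auto
      have "cell x = c" if "s < x" "x \<le> j" for x
        using r(10)[OF j, of x] True s that by simp
      then show ?thesis
        using \<open>s < j\<close> r(6,7)[OF j] lab_j[OF j] True js sp s unfolding cell'_def start'_def
        by (auto simp: image_subset_iff)
    next
      case False
      have "cell' j' = cell j" if "start (cell j) \<le> j'" "j' \<le> j" for j'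
        using r(10)[OF j that] cs False unfolding cell'_def by auto
      then show ?thesis
        using r(6-9)[OF j] lab_j[OF j] False js unfolding cell'_def start'_def
        by (auto simp: image_subset_iff)
    qed
  qed
  have sorted: "(lab' (ord' j), lab' (ord' j')) \<notin> lexord less_than" if j: "b \<le> j" "j \<le> j'" "j' < n" for j j'
  proof -
    have old: "(lab (ord j), lab (ord j')) \<notin> lexord less_than" using r(11) j by blast
    have L: "lab (ord s) = LB c" using r(7)[of s] sp cs by auto
    consider "j = s" "j' = s" | "j = s" "j' \<noteq> s" | "j \<noteq> s" "j' = s" | "j \<noteq> s" "j' \<noteq> s" by blast
    then show ?thesis
    proof cases
      case 1
      then show ?thesis by (auto intro!: lexord_irreflexive)
    next
      case 2
      then show ?thesis
        using old L lexord_snoc_left[of "LB c" "lab (ord j')"] lab_j[of j] lab_j[of j'] j by auto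
    next
      \<comment> \<open>Positions before the front \<open>s\<close> belong to other classes, so
        their labels differ from \<open>LB c\<close>, as \<open>lexord_snoc_right\<close>
        requires.\<close>
      case 3
      then have "j < s" using j by auto
      then have "cell j \<noteq> c" using r(9)[of j] j s by auto
      then have "LB (cell j) \<noteq> LB c" using inj_onD[OF r(5), of "cell j" c] r(6)[of j] cK j by auto
      then have "lab (ord j) \<noteq> LB c" "\<forall>x\<in>set (lab (ord j)). k \<le> x"
        using r(6,7)[of j] spl1[of "cell j"] j by auto
      then show ?thesis
        using old L lexord_snoc_right[of "lab (ord j)" "LB c" k] lab_j[of j] lab_j[of j'] j 3 by auto
    next
      case 4
      then show ?thesis using old lab_j[of j] lab_j[of j'] j by auto
    qed
  qed
  have "refinement n b lab' ord' pos' cell' start' K LB"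
    using perm perm' r(5) cells sorted unfolding refinement_def by blast
  moreover have "new d < K \<and> LB (new d) = LB d @ [k] \<and> b \<le> start' (new d) \<and> start' (new d) \<le> start' d \<and>
      cell' ` {start' (new d)..<start' d} \<subseteq> {new d}"
    if d: "d < K" "k \<notin> set (LB d)" "stamp d = b" for d
  proof (cases "d = c")
    case True
    then show ?thesis
      using new_c unclean[OF d] s unfolding start'_def cell'_def by (auto simp: less_Suc_eq image_subset_iff)
  next
    case False
    have "cell' j = new d" if "start (new d) \<le> j" "j < start d" for j
      using new[OF d] that cs unclean[OF d] unfolding cell'_def by (auto simp: image_subset_iff)
    then show ?thesis
      using new[OF d] False unclean[OF d] unfolding start'_def by (auto simp: image_subset_iff)
  qed
  ultimately have "splitting n b k lab' ord' pos' cell' start' new stamp K LB"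
    using spl1 spl2 unfolding splitting_def by auto
  then show ?thesis unfolding ord'_def pos'_def cell'_def start'_def lab'_def .
qed

section \<open>The program and its running time\<close>

text \<open>An existential suffices for total correctness, since \<open>exec\<close> is
  deterministic; the postcondition also receives the number of steps.\<close>

definition wp :: "program \<Rightarrow> (nat \<Rightarrow> state \<Rightarrow> bool) \<Rightarrow> state \<Rightarrow> bool" where
  "wp P Q \<sigma> \<longleftrightarrow> (\<exists>t \<sigma>'. exec P \<sigma> t \<sigma>' \<and> Q t \<sigma>')"

lemma wp_Skip [simp]: "wp Skip Q \<sigma> \<longleftrightarrow> Q 1 \<sigma>"
  unfolding wp_def One_nat_def by (blast intro: exec.Skip[unfolded One_nat_def] elim: exec_elims)

lemma wp_Assign [simp]: "wp (Assign x e) Q (r, m) \<longleftrightarrow> Q 1 (r(x := eval_expr e (r, m)), m)"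
  unfolding wp_def One_nat_def
  by (blast intro: exec.Assign[of x e "(r, m)", unfolded fst_conv snd_conv One_nat_def]
      elim: exec_elims(2)[of x e "(r, m)", unfolded fst_conv snd_conv])

lemma wp_Store [simp]:
  "wp (Store a e1 e2) Q (r, m) \<longleftrightarrow>
    Q 1 (r, m(a := (m a)(eval_expr e1 (r, m) := eval_expr e2 (r, m))))"
  unfolding wp_def One_nat_def
  by (blast intro: exec.Store[of a e1 e2 "(r, m)", unfolded fst_conv snd_conv One_nat_def]
      elim: exec_elims(3)[of a e1 e2 "(r, m)", unfolded fst_conv snd_conv])

lemma wp_Seq [simp]: "wp (Seq P P') Q \<sigma> \<longleftrightarrow> wp P (\<lambda>t. wp P' (\<lambda>u. Q (t + u))) \<sigma>"
  unfolding wp_def by (blast intro: exec.Seq elim: exec_elims)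

lemma wp_Cond [simp]:
  "wp (Cond b P P') Q \<sigma> \<longleftrightarrow> (if eval_test b \<sigma> then wp P (\<lambda>t. Q (1 + t)) \<sigma> else wp P' (\<lambda>t. Q (1 + t)) \<sigma>)"
  unfolding wp_def by (auto intro: exec.Cond_True[simplified] exec.Cond_False[simplified] simp del: split_paired_Ex
      elim!: exec_elims)

lemma wp_mono: "wp P Q \<sigma> \<Longrightarrow> (\<And>t \<sigma>'. Q t \<sigma>' \<Longrightarrow> Q' t \<sigma>') \<Longrightarrow> wp P Q' \<sigma>"
  unfolding wp_def by blast

text \<open>The potential pays for the body and the successful test of each round. It strictly
  decreases, so termination comes with the time bound; the extra \<open>Suc\<close> is the final
  failing test.\<close>

lemma wp_While:
  fixes \<Phi> :: "state \<Rightarrow> nat"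
  assumes step: "\<And>\<sigma>. I \<sigma> \<Longrightarrow> eval_test b \<sigma> \<Longrightarrow> wp P (\<lambda>t \<sigma>'. I \<sigma>' \<and> Suc t + \<Phi> \<sigma>' \<le> \<Phi> \<sigma>) \<sigma>"
  shows "I \<sigma> \<Longrightarrow> wp (While b P) (\<lambda>t \<sigma>'. I \<sigma>' \<and> \<not> eval_test b \<sigma>' \<and> t + \<Phi> \<sigma>' \<le> Suc (\<Phi> \<sigma>)) \<sigma>"
proof (induction "\<Phi> \<sigma>" arbitrary: \<sigma> rule: less_induct)
  case less
  show ?case
  proof (cases "eval_test b \<sigma>")
    case False
    then show ?thesis using exec.While_False less.prems unfolding wp_def by fastforce
  next
    case True
    obtain t1 \<sigma>1 where 1: "exec P \<sigma> t1 \<sigma>1" "I \<sigma>1" "Suc t1 + \<Phi> \<sigma>1 \<le> \<Phi> \<sigma>"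
      using step[OF less.prems True] unfolding wp_def by blast
    have "\<Phi> \<sigma>1 < \<Phi> \<sigma>" using 1(3) by simp
    then obtain t2 \<sigma>2 where 2: "exec (While b P) \<sigma>1 t2 \<sigma>2" "I \<sigma>2" "\<not> eval_test b \<sigma>2"
        "t2 + \<Phi> \<sigma>2 \<le> Suc (\<Phi> \<sigma>1)"
      using less.hyps[of \<sigma>1] 1(2) unfolding wp_def by blast
    have "1 + t1 + t2 + \<Phi> \<sigma>2 \<le> Suc (\<Phi> \<sigma>)" using 1(3) 2(4) by simp
    then show ?thesis using exec.While_True[OF True 1(1) 2(1)] 2 unfolding wp_def by blast
  qed
qed

section \<open>The program\<close>

definition init_loop :: program where
  "init_loop = While (Less (Reg ''i'') (Reg ''n''))
    (Seq (Store ''ord'' (Reg ''i'') (Reg ''i''))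
    (Seq (Store ''pos'' (Reg ''i'') (Reg ''i''))
    (Seq (Store ''cell'' (Reg ''i'') (Const 0))
      (Assign ''i'' (Plus (Reg ''i'') (Const 1))))))"

text \<open>The register \<open>k\<close> counts the class identifiers in use and thus supplies the
  next one; it is not the number being handed out.\<close>

definition new_class :: program where
  "new_class =
     Seq (Store ''new'' (Reg ''c'') (Reg ''k''))
    (Seq (Store ''start'' (Reg ''k'') (Read ''start'' (Reg ''c'')))
    (Seq (Store ''stamp'' (Reg ''k'') (Const 0))
    (Seq (Store ''stamp'' (Reg ''c'') (Plus (Reg ''i'') (Const 1)))
      (Assign ''k'' (Plus (Reg ''k'') (Const 1))))))"

definition move_vertex :: program where
  "move_vertex =
     Seq (Assign ''s'' (Read ''start'' (Reg ''c'')))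
    (Seq (Store ''ord'' (Reg ''p'') (Read ''ord'' (Reg ''s'')))
    (Seq (Store ''pos'' (Read ''ord'' (Reg ''s'')) (Reg ''p''))
    (Seq (Store ''ord'' (Reg ''s'') (Read ''adj'' (Reg ''e'')))
    (Seq (Store ''pos'' (Read ''adj'' (Reg ''e'')) (Reg ''s''))
    (Seq (Store ''cell'' (Reg ''s'') (Read ''new'' (Reg ''c'')))
      (Store ''start'' (Reg ''c'') (Plus (Reg ''s'') (Const 1))))))))"

text \<open>Positions up to \<open>i\<close> hold visited vertices, which the outer test skips. The
  stamp \<open>i + 1\<close> identifies the current visit, so stamps of earlier visits are
  recognized as outdated without being reset.\<close>

definition process_neighbour :: program where
  "process_neighbour =
     Seq (Assign ''p'' (Read ''pos'' (Read ''adj'' (Reg ''e''))))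
    (Seq (Cond (Less (Reg ''i'') (Reg ''p''))
       (Seq (Assign ''c'' (Read ''cell'' (Reg ''p'')))
       (Seq (Cond (Equal (Read ''stamp'' (Reg ''c'')) (Plus (Reg ''i'') (Const 1))) Skip new_class)
         move_vertex))
       Skip)
      (Assign ''e'' (Plus (Reg ''e'') (Const 1))))"

definition neighbour_loop :: program where
  "neighbour_loop =
     While (Less (Reg ''e'') (Read ''off'' (Plus (Read ''ord'' (Reg ''i'')) (Const 1)))) process_neighbour"

definition visit_vertex :: program where
  "visit_vertex =
     Seq (Store ''start'' (Read ''cell'' (Reg ''i'')) (Plus (Reg ''i'') (Const 1)))
    (Seq (Assign ''e'' (Read ''off'' (Read ''ord'' (Reg ''i''))))
    (Seq neighbour_loop
      (Assign ''i'' (Plus (Reg ''i'') (Const 1)))))"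

definition lex_bfs_program :: program where
  "lex_bfs_program =
     Seq (Assign ''i'' (Const 0))
    (Seq init_loop
    (Seq (Store ''start'' (Const 0) (Const 0))
    (Seq (Store ''stamp'' (Const 0) (Const 0))
    (Seq (Assign ''k'' (Const 1))
    (Seq (Assign ''i'' (Const 0))
      (While (Less (Reg ''i'') (Reg ''n'')) visit_vertex))))))"

lemma wp_new_class:
  "wp new_class Q (r, m) \<longleftrightarrow>
    Q 5 (r(''k'' := Suc (r ''k'')),
      m(''new'' := (m ''new'')(r ''c'' := r ''k''),
        ''start'' := (m ''start'')(r ''k'' := m ''start'' (r ''c'')),
        ''stamp'' := (m ''stamp'')(r ''k'' := 0, r ''c'' := Suc (r ''i''))))"
  unfolding new_class_def by (simp add: eval_nat_numeral fun_upd_twist)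

lemma wp_move_vertex:
  "wp move_vertex Q (r, m) \<longleftrightarrow>
    (let s = m ''start'' (r ''c''); w = m ''adj'' (r ''e'') in
    Q 7 (r(''s'' := s),
      m(''ord'' := (m ''ord'')(r ''p'' := m ''ord'' s, s := w),
        ''pos'' := (m ''pos'')(m ''ord'' s := r ''p'', w := s),
        ''cell'' := (m ''cell'')(s := m ''new'' (r ''c'')),
        ''start'' := (m ''start'')(r ''c'' := Suc s))))"
  unfolding move_vertex_def Let_def by (simp add: eval_nat_numeral fun_upd_twist)

section \<open>Invariants and cost of the search\<close>

definition lex_bfs_input ::
  "'a set \<Rightarrow> 'a set set \<Rightarrow> (nat \<Rightarrow> 'a) \<Rightarrow> (nat \<Rightarrow> nat) \<Rightarrow> (nat \<Rightarrow> nat) \<Rightarrow> bool" where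
  "lex_bfs_input V E \<nu> off adj \<longleftrightarrow>
     simple_graph V E \<and> bij_betw \<nu> {..<card V} V \<and>
     (\<forall>i<card V. off i \<le> off (Suc i) \<and>
        bij_betw adj {off i..<off (Suc i)} {j. j < card V \<and> {\<nu> i, \<nu> j} \<in> E})"

context
  fixes V :: "'a set" and E :: "'a set set" and \<nu> :: "nat \<Rightarrow> 'a" and off adj :: "nat \<Rightarrow> nat"
  assumes input: "lex_bfs_input V E \<nu> off adj"
begin

lemma input_simple: "simple_graph V E"
  and bij_\<nu>: "bij_betw \<nu> {..<card V} V"
  and off_mono: "i < card V \<Longrightarrow> off i \<le> off (Suc i)"
  and bij_adj: "i < card V \<Longrightarrow>
    bij_betw adj {off i..<off (Suc i)} {j. j < card V \<and> {\<nu> i, \<nu> j} \<in> E}"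
  using input unfolding lex_bfs_input_def by simp_all

definition holds_input :: "state \<Rightarrow> bool" where
  "holds_input \<sigma> \<longleftrightarrow> fst \<sigma> ''n'' = card V \<and> snd \<sigma> ''off'' = off \<and> snd \<sigma> ''adj'' = adj"

text \<open>
  The list xs consists of the visited vertices, and the neighbours of the last one are being
  processed; lab is the labelling before its visit.
\<close>

definition updated_label :: "nat list \<Rightarrow> ('a \<Rightarrow> nat list) \<Rightarrow> nat \<Rightarrow> nat \<Rightarrow> nat \<Rightarrow> nat list" where
  "updated_label xs lab k e x =
     (if x \<in> adj ` {off (last xs)..<e} - set xs then lab (\<nu> x) @ [k] else lab (\<nu> x))"

definition neighbour_inv :: "nat \<Rightarrow> nat list \<Rightarrow> ('a \<Rightarrow> nat list) \<Rightarrow> state \<Rightarrow> bool" where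
  "neighbour_inv i xs lab \<sigma> \<longleftrightarrow> holds_input \<sigma> \<and> fst \<sigma> ''i'' = i \<and>
     off (last xs) \<le> fst \<sigma> ''e'' \<and> fst \<sigma> ''e'' \<le> off (Suc (last xs)) \<and>
     map (snd \<sigma> ''ord'') [0..<Suc i] = xs \<and>
     (\<exists>LB. splitting (card V) (Suc i) (card V - i) (updated_label xs lab (card V - i) (fst \<sigma> ''e''))
        (snd \<sigma> ''ord'') (snd \<sigma> ''pos'') (snd \<sigma> ''cell'') (snd \<sigma> ''start'')
        (snd \<sigma> ''new'') (snd \<sigma> ''stamp'') (fst \<sigma> ''k'') LB)"

text \<open>The longest branch creates a class and moves the vertex in 17 steps; with the loop test
  this is below the charge of 20 for one list entry.\<close>

lemma wp_process_neighbour: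
  assumes i: "i < card V" and v: "v = last xs" "v < card V"
    and clean: "\<And>x. x < card V \<Longrightarrow> x \<notin> set xs \<Longrightarrow> card V - i \<notin> set (lab (\<nu> x))"
    and inv: "neighbour_inv i xs lab (r, m)" and e: "r ''e'' < off (Suc v)"
  shows "wp process_neighbour (\<lambda>t \<sigma>'. neighbour_inv i xs lab \<sigma>' \<and>
      Suc t + 20 * (off (Suc v) - fst \<sigma>' ''e'') \<le> 20 * (off (Suc v) - r ''e'')) (r, m)"
proof -
  define w where "w = adj (r ''e'')"
  define p where "p = m ''pos'' w"
  define c where "c = m ''cell'' p"
  define s where "s = m ''start'' c"
  define K where "K = r ''k''"
  let ?lab = "updated_label xs lab (card V - i)"
  have input: "r ''n'' = card V" "m ''off'' = off" "m ''adj'' = adj"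
    and ri: "r ''i'' = i" and e_bounds: "off v \<le> r ''e''"
    and xs: "map (m ''ord'') [0..<Suc i] = xs"
    using inv v unfolding neighbour_inv_def holds_input_def by simp_all
  obtain LB where spl: "splitting (card V) (Suc i) (card V - i) (?lab (r ''e'')) (m ''ord'') (m ''pos'') (m ''cell'')
      (m ''start'') (m ''new'') (m ''stamp'') K LB"
    using inv unfolding neighbour_inv_def K_def by auto
  note ref = splittingD(1)[OF spl]
  note R = refinementD[OF ref]
  have set_xs: "x \<in> set xs \<longleftrightarrow> m ''pos'' x \<le> i" if "x < card V" for x
  proof
    assume "x \<in> set xs"
    then obtain j where "j \<le> i" "x = m ''ord'' j" unfolding xs[symmetric] by (auto simp: less_Suc_eq_le simp del: upt_Suc)
    then show "m ''pos'' x \<le> i" using R(2)[of j] i by simp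
  next
    assume "m ''pos'' x \<le> i"
    then show "x \<in> set xs" using R(4)[OF that] unfolding xs[symmetric]
      by (auto simp: less_Suc_eq_le simp del: upt_Suc intro!: image_eqI[of _ _ "m ''pos'' x"])
  qed
  \<comment> \<open>Each neighbour is listed once, so \<open>w\<close> has not received the current
    number before.\<close>
  have w: "w < card V" "w \<notin> adj ` {off v..<r ''e''}"
  proof -
    have "w \<in> adj ` {off v..<off (Suc v)}" unfolding w_def using e e_bounds by auto
    then show "w < card V" using bij_adj[OF v(2)] unfolding bij_betw_def by auto
    show "w \<notin> adj ` {off v..<r ''e''}"
    proof
      assume "w \<in> adj ` {off v..<r ''e''}"
      then obtain e' where "off v \<le> e'" "e' < r ''e''" "adj e' = adj (r ''e'')" unfolding w_def by auto
      then show False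
        using inj_onD[OF bij_betw_imp_inj_on[OF bij_adj[OF v(2)]], of e' "r ''e''"] e e_bounds by auto
    qed
  qed
  have insert_w: "adj ` {off v..<Suc (r ''e'')} = insert w (adj ` {off v..<r ''e''})"
    using e_bounds by (simp add: atLeastLessThanSuc w_def)
  show ?thesis
  proof (cases "i < p")
    case False
    then have "w \<in> set xs" using set_xs w unfolding p_def by simp
    then have "?lab (Suc (r ''e'')) = ?lab (r ''e'')"
      using insert_w v unfolding updated_label_def by auto
    then show ?thesis
      using False inv e ri input v unfolding process_neighbour_def neighbour_inv_def holds_input_def
      by (auto simp: p_def w_def)
  next
    case True
    then have w_xs: "w \<notin> set xs" using set_xs w unfolding p_def by simp
    then have lab_e: "?lab (Suc (r ''e'')) = (?lab (r ''e''))(w := ?lab (r ''e'') w @ [card V - i])"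
      using insert_w v w unfolding updated_label_def by (auto simp: fun_eq_iff)
    have p: "p < card V" "m ''ord'' p = w" using R(3,4)[OF w(1)] unfolding p_def by auto
    have cK: "c < K" and "LB c = ?lab (r ''e'') w" and s: "Suc i \<le> s"
      using R(6)[of p] R(7)[of p] R(8)[of p] p True unfolding c_def s_def by auto
    then have k: "card V - i \<notin> set (LB c)"
      using clean[OF w(1) w_xs] w(2) v unfolding updated_label_def by auto
    have sp: "s \<le> p" using R(9)[of p] p True unfolding s_def c_def by auto
    \<comment> \<open>The swap takes place beyond position \<open>i\<close> and leaves the visited
      part unchanged.\<close>
    have ord: "map ((m ''ord'')(p := m ''ord'' s, s := w)) [0..<Suc i] = xs"
      using s True xs by (auto simp: less_Suc_eq_le simp del: upt_Suc)
    show ?thesis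
    proof (cases "m ''stamp'' c = Suc i")
      case stamp: True
      have "splitting (card V) (Suc i) (card V - i) (?lab (Suc (r ''e''))) ((m ''ord'')(p := m ''ord'' s, s := w))
          ((m ''pos'')(m ''ord'' s := p, w := s)) ((m ''cell'')(s := m ''new'' c))
          ((m ''start'')(c := Suc s)) (m ''new'') (m ''stamp'') K LB"
        unfolding lab_e using True
        by (intro splitting_move[OF spl _ p(1) p(2)[symmetric] c_def k stamp s_def]) simp
      then show ?thesis
        using inv e ri input v True stamp ord unfolding process_neighbour_def neighbour_inv_def holds_input_def
        by (auto simp: wp_move_vertex p_def w_def c_def s_def K_def Let_def simp del: upt_Suc)
    next
      case stamp: False
      have spl': "splitting (card V) (Suc i) (card V - i) (?lab (r ''e'')) (m ''ord'') (m ''pos'') (m ''cell'')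
          ((m ''start'')(K := s)) ((m ''new'')(c := K)) ((m ''stamp'')(K := 0, c := Suc i))
          (Suc K) (LB(K := LB c @ [card V - i]))"
        using splitting_new_class[OF spl cK k stamp] s unfolding s_def by simp
      have "splitting (card V) (Suc i) (card V - i) (?lab (Suc (r ''e''))) ((m ''ord'')(p := m ''ord'' s, s := w))
          ((m ''pos'')(m ''ord'' s := p, w := s)) ((m ''cell'')(s := K))
          ((m ''start'')(K := s, c := Suc s)) ((m ''new'')(c := K)) ((m ''stamp'')(K := 0, c := Suc i))
          (Suc K) (LB(K := LB c @ [card V - i]))"
        unfolding lab_e using splitting_move[OF spl' _ p(1) p(2)[symmetric] c_def, of s] True k cK s_def by simp
      then show ?thesis
        using inv e ri input v True stamp ord cK unfolding process_neighbour_def neighbour_inv_def holds_input_def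
        by (auto simp: wp_move_vertex wp_new_class p_def w_def c_def s_def K_def Let_def simp del: upt_Suc)
    qed
  qed
qed


text \<open>Unvisited vertices occupy the positions from \<open>i\<close> on, sorted by decreasing
  labels, so the vertex at \<open>i\<close> is a legal next visit.\<close>

lemma lex_bfs_run_extend:
  assumes run: "lex_bfs_run V E (map (\<lambda>j. \<nu> (ord j)) [0..<i]) lab" and i: "i < card V"
    and ref: "refinement (card V) i (\<lambda>x. lab (\<nu> x)) ord pos cell start K LB"
  shows "lex_bfs_run V E (map (\<lambda>j. \<nu> (ord j)) [0..<Suc i])
    (\<lambda>w. if w \<in> neighbours V E (\<nu> (ord i)) - (\<lambda>j. \<nu> (ord j)) ` {..<i} then lab w @ [card V - i] else lab w)"
proof -
  note R = refinementD[OF ref]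
  let ?vs = "map (\<lambda>j. \<nu> (ord j)) [0..<i]"
  have inj: "\<nu> x = \<nu> y \<longleftrightarrow> x = y" if "x < card V" "y < card V" for x y
    using inj_on_eq_iff[OF bij_betw_imp_inj_on[OF bij_\<nu>]] that by simp
  have set_vs: "set ?vs = (\<lambda>j. \<nu> (ord j)) ` {..<i}" by (auto simp: atLeast0LessThan)
  have "\<nu> (ord i) \<in> V" using bij_betwE[OF bij_\<nu>] R(1)[OF i] by auto
  moreover have "\<nu> (ord i) \<notin> set ?vs"
  proof
    assume "\<nu> (ord i) \<in> set ?vs"
    then obtain j where "j < i" "\<nu> (ord i) = \<nu> (ord j)" by auto
    then have "ord i = ord j" using inj[of "ord i" "ord j"] R(1) i by auto
    then show False using R(2)[of i] R(2)[of j] i \<open>j < i\<close> by simp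
  qed
  ultimately have v: "\<nu> (ord i) \<in> V - set ?vs" by blast
  have "(lab (\<nu> (ord i)), lab w) \<notin> lexord less_than" if w: "w \<in> V - set ?vs" for w
  proof -
    obtain x where x: "x < card V" "w = \<nu> x" using bij_betw_imp_surj_on[OF bij_\<nu>] w by blast
    have "\<not> pos x < i"
    proof
      assume "pos x < i"
      then have "\<nu> (ord (pos x)) \<in> set ?vs" by auto
      then show False using w x R(4)[OF x(1)] by auto
    qed
    then show ?thesis using R(11)[of i "pos x"] R(3,4)[OF x(1)] x by auto
  qed
  then have "lex_bfs_run V E (?vs @ [\<nu> (ord i)])
      (\<lambda>w. if w \<in> neighbours V E (\<nu> (ord i)) - set ?vs then lab w @ [card V - length ?vs] else lab w)"
    using lex_bfs_run.visit[OF run v] by blast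
  moreover have "length ?vs = i" by simp
  ultimately show ?thesis unfolding set_vs by (simp only: upt_Suc_append map_append list.map le0)
qed

text \<open>
  Every unvisited vertex x is charged with the cost of its later visit.
\<close>

definition potential :: "state \<Rightarrow> nat" where
  "potential \<sigma> = (\<Sum>x\<in>{..<card V} - snd \<sigma> ''ord'' ` {..<fst \<sigma> ''i''}. 5 + 20 * (off (Suc x) - off x))"

text \<open>The last condition makes the next visit start afresh: no label contains its number
  \<open>card V - i\<close> yet, and no stamp equals \<open>i + 1\<close>.\<close>

definition search_inv :: "state \<Rightarrow> bool" where
  "search_inv \<sigma> \<longleftrightarrow> holds_input \<sigma> \<and> fst \<sigma> ''i'' \<le> card V \<and>
     (\<exists>lab LB. lex_bfs_run V E (map (\<lambda>j. \<nu> (snd \<sigma> ''ord'' j)) [0..<fst \<sigma> ''i'']) lab \<and>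
        refinement (card V) (fst \<sigma> ''i'') (\<lambda>x. lab (\<nu> x)) (snd \<sigma> ''ord'') (snd \<sigma> ''pos'') (snd \<sigma> ''cell'')
          (snd \<sigma> ''start'') (fst \<sigma> ''k'') LB \<and>
        (\<forall>c<fst \<sigma> ''k''. snd \<sigma> ''stamp'' c \<le> fst \<sigma> ''i'' \<and> set (LB c) \<subseteq> {card V - fst \<sigma> ''i''<..}))"

lemma wp_visit_vertex:
  assumes inv: "search_inv (r, m)" and i: "r ''i'' < card V"
  shows "wp visit_vertex (\<lambda>t \<sigma>'. search_inv \<sigma>' \<and> Suc t + potential \<sigma>' \<le> potential (r, m)) (r, m)"
proof -
  define i where "i = r ''i''"
  have "i < card V" using i by (simp add: i_def)
  define v where "v = m ''ord'' i"
  define xs where "xs = map (m ''ord'') [0..<Suc i]"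
  have input: "r ''n'' = card V" "m ''off'' = off" "m ''adj'' = adj"
    using inv unfolding search_inv_def holds_input_def by auto
  obtain lab LB where run: "lex_bfs_run V E (map (\<lambda>j. \<nu> (m ''ord'' j)) [0..<i]) lab"
    and ref: "refinement (card V) i (\<lambda>x. lab (\<nu> x)) (m ''ord'') (m ''pos'') (m ''cell'') (m ''start'') (r ''k'') LB"
    and fresh: "\<And>c. c < r ''k'' \<Longrightarrow> m ''stamp'' c \<le> i \<and> set (LB c) \<subseteq> {card V - i<..}"
    using inv unfolding search_inv_def i_def by auto
  note R = refinementD[OF ref]
  have v: "v < card V" "v = last xs" using R(1) \<open>i < card V\<close> unfolding v_def xs_def by auto
  have set_xs: "set xs = m ''ord'' ` {..i}"
    unfolding xs_def by (auto simp: less_Suc_eq_le simp del: upt_Suc)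
  have clean: "card V - i \<notin> set (lab (\<nu> x))" if "x < card V" "x \<notin> set xs" for x
  proof -
    have "\<not> m ''pos'' x \<le> i" using that R(4)[OF that(1)] unfolding set_xs by force
    then show ?thesis
      using R(6,7)[of "m ''pos'' x"] fresh[of "m ''cell'' (m ''pos'' x)"] R(3,4)[OF that(1)] by auto
  qed
  define \<sigma>1 where "\<sigma>1 = (r(''e'' := off v), m(''start'' := (m ''start'')(m ''cell'' i := Suc i)))"
  have "updated_label xs lab (card V - i) (off v) = (\<lambda>x. lab (\<nu> x))"
    unfolding updated_label_def using v by auto
  then have inv1: "neighbour_inv i xs lab \<sigma>1"
    using splitting_start[OF ref \<open>i < card V\<close> fresh, where new = "m ''new''"] input off_mono[OF v(1)] v(2)
    unfolding neighbour_inv_def holds_input_def \<sigma>1_def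
    by (auto simp: i_def[symmetric] xs_def[symmetric] simp del: upt_Suc)
  have loop: "wp neighbour_loop (\<lambda>t \<sigma>. neighbour_inv i xs lab \<sigma> \<and> fst \<sigma> ''e'' = off (Suc v) \<and>
      t \<le> Suc (20 * (off (Suc v) - off v))) \<sigma>1"
  proof -
    let ?b = "Less (Reg ''e'') (Read ''off'' (Plus (Read ''ord'' (Reg ''i'')) (Const 1)))"
    let ?\<Phi> = "\<lambda>\<sigma>. 20 * (off (Suc v) - fst \<sigma> ''e'')"
    have test: "eval_test ?b \<sigma> \<longleftrightarrow> fst \<sigma> ''e'' < off (Suc v)" if "neighbour_inv i xs lab \<sigma>" for \<sigma>
      using that v(2) unfolding neighbour_inv_def holds_input_def by auto
    have "wp process_neighbour (\<lambda>t \<sigma>'. neighbour_inv i xs lab \<sigma>' \<and> Suc t + ?\<Phi> \<sigma>' \<le> ?\<Phi> \<sigma>) \<sigma>"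
      if "neighbour_inv i xs lab \<sigma>" "eval_test ?b \<sigma>" for \<sigma>
      using wp_process_neighbour[of i v xs lab "fst \<sigma>" "snd \<sigma>"] \<open>i < card V\<close> v clean that test by simp
    then have "wp neighbour_loop (\<lambda>t \<sigma>'. neighbour_inv i xs lab \<sigma>' \<and> \<not> eval_test ?b \<sigma>' \<and>
        t + ?\<Phi> \<sigma>' \<le> Suc (?\<Phi> \<sigma>1)) \<sigma>1"
      unfolding neighbour_loop_def using inv1 by (intro wp_While) auto
    then show ?thesis
    proof (rule wp_mono, elim conjE, intro conjI)
      fix t \<sigma>
      assume inv: "neighbour_inv i xs lab \<sigma>" and "\<not> eval_test ?b \<sigma>" "t + ?\<Phi> \<sigma> \<le> Suc (?\<Phi> \<sigma>1)"
      moreover have "fst \<sigma> ''e'' \<le> off (Suc v)" using inv v(2) unfolding neighbour_inv_def by auto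
      ultimately show "fst \<sigma> ''e'' = off (Suc v)" "t \<le> Suc (20 * (off (Suc v) - off v))"
        using test unfolding \<sigma>1_def by auto
    qed
  qed
  \<comment> \<open>The \<open>4\<close> accounts for three single commands and the outer loop test.
    Together with the failing inner test within \<open>t\<close> this gives the summand 5 of
    \<open>potential\<close>.\<close>
  have final: "search_inv (r2(''i'' := Suc i), m2) \<and> 4 + t + potential (r2(''i'' := Suc i), m2) \<le> potential (r, m)"
    if t: "t \<le> Suc (20 * (off (Suc v) - off v))" and inv2: "neighbour_inv i xs lab (r2, m2)"
      and e: "r2 ''e'' = off (Suc v)" for t r2 m2
  proof -
    have input2: "holds_input (r2, m2)" and "r2 ''i'' = i" and xs2: "map (m2 ''ord'') [0..<Suc i] = xs"
      using inv2 unfolding neighbour_inv_def by auto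
    obtain LB2 where spl: "splitting (card V) (Suc i) (card V - i) (updated_label xs lab (card V - i) (off (Suc v)))
        (m2 ''ord'') (m2 ''pos'') (m2 ''cell'') (m2 ''start'') (m2 ''new'') (m2 ''stamp'') (r2 ''k'') LB2"
      using inv2 e unfolding neighbour_inv_def by auto
    note R2 = refinementD[OF splittingD(1)[OF spl]]
    have same: "m2 ''ord'' j = m ''ord'' j" if "j \<le> i" for j
      using xs2 that unfolding xs_def by (auto simp: less_Suc_eq_le simp del: upt_Suc)
    define lab2 where "lab2 = (\<lambda>w. if w \<in> neighbours V E (\<nu> v) - (\<lambda>j. \<nu> (m ''ord'' j)) ` {..<i}
      then lab w @ [card V - i] else lab w)"
    have "lex_bfs_run V E (map (\<lambda>j. \<nu> (m ''ord'' j)) [0..<Suc i]) lab2"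
      unfolding lab2_def v_def by (rule lex_bfs_run_extend[OF run \<open>i < card V\<close> ref])
    moreover have "map (\<lambda>j. \<nu> (m2 ''ord'' j)) [0..<Suc i] = map (\<lambda>j. \<nu> (m ''ord'' j)) [0..<Suc i]"
      using same by (simp add: less_Suc_eq_le del: upt_Suc)
    ultimately have run2: "lex_bfs_run V E (map (\<lambda>j. \<nu> (m2 ''ord'' j)) [0..<Suc i]) lab2" by (simp only:)
    \<comment> \<open>The two labellings are compared at unvisited vertices, since
      \<open>refinement\<close> with boundary \<open>Suc i\<close> reads labels only there.\<close>
    have lab2: "updated_label xs lab (card V - i) (off (Suc v)) x = lab2 (\<nu> x)" if x: "x < card V" "x \<notin> set xs" for x
    proof -
      have "x \<in> adj ` {off v..<off (Suc v)} \<longleftrightarrow> {\<nu> v, \<nu> x} \<in> E"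
        using bij_adj[OF v(1)] x unfolding bij_betw_def by auto
      moreover have "\<nu> x \<in> V" using bij_betwE[OF bij_\<nu>] x by auto
      moreover have "\<nu> x \<notin> (\<lambda>j. \<nu> (m ''ord'' j)) ` {..<i}"
      proof
        assume "\<nu> x \<in> (\<lambda>j. \<nu> (m ''ord'' j)) ` {..<i}"
        then obtain j where j: "j < i" "\<nu> x = \<nu> (m ''ord'' j)" by auto
        then have "x = m ''ord'' j"
          using inj_onD[OF bij_betw_imp_inj_on[OF bij_\<nu>], of x "m ''ord'' j"] x R(1)[of j] \<open>i < card V\<close> by auto
        then show False using x j unfolding set_xs by auto
      qed
      ultimately show ?thesis
        using v(2) x unfolding updated_label_def lab2_def neighbours_def by auto
    qed
    have unvisited: "m2 ''ord'' j \<notin> set xs" if "Suc i \<le> j" "j < card V" for j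
    proof
      assume "m2 ''ord'' j \<in> set xs"
      then obtain j' where "j' \<le> i" "m2 ''ord'' j = m2 ''ord'' j'"
        unfolding xs2[symmetric] by (auto simp: less_Suc_eq_le simp del: upt_Suc)
      then show False using R2(2)[of j] R2(2)[of j'] that by simp
    qed
    have "updated_label xs lab (card V - i) (off (Suc v)) (m2 ''ord'' j) = lab2 (\<nu> (m2 ''ord'' j))"
      if "Suc i \<le> j" "j < card V" for j
      using lab2 unvisited R2(1) that by blast
    then have ref2: "refinement (card V) (Suc i) (\<lambda>x. lab2 (\<nu> x)) (m2 ''ord'') (m2 ''pos'') (m2 ''cell'')
        (m2 ''start'') (r2 ''k'') LB2"
      using splittingD(1)[OF spl] unfolding refinement_def by simp
    have fresh2: "m2 ''stamp'' c \<le> Suc i \<and> set (LB2 c) \<subseteq> {card V - Suc i<..}" if "c < r2 ''k''" for c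
      using splittingD(2)[OF spl that] \<open>i < card V\<close> by auto
    have "search_inv (r2(''i'' := Suc i), m2)"
      using input2 \<open>i < card V\<close> run2 ref2 fresh2 unfolding search_inv_def holds_input_def
      by (auto simp del: upt_Suc)
    \<comment> \<open>Visiting \<open>v\<close> removes exactly its own summand.\<close>
    moreover have "potential (r, m) =
        5 + 20 * (off (Suc v) - off v) + potential (r2(''i'' := Suc i), m2)"
    proof -
      have "m2 ''ord'' ` {..<Suc i} = insert v (m ''ord'' ` {..<i})"
        using same unfolding lessThan_Suc v_def by auto
      moreover have "v \<notin> m ''ord'' ` {..<i}"
      proof
        assume "v \<in> m ''ord'' ` {..<i}"
        then obtain j where "j < i" "m ''ord'' i = m ''ord'' j" unfolding v_def by auto
        then show False using R(2)[of i] R(2)[of j] \<open>i < card V\<close> by simp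
      qed
      ultimately have "{..<card V} - m ''ord'' ` {..<i} = insert v ({..<card V} - m2 ''ord'' ` {..<Suc i})"
        "v \<notin> {..<card V} - m2 ''ord'' ` {..<Suc i}"
        using v(1) by auto
      then show ?thesis unfolding potential_def by (simp add: i_def[symmetric])
    qed
    ultimately show ?thesis using t by simp
  qed
  have "wp neighbour_loop (\<lambda>t. wp (Assign ''i'' (Plus (Reg ''i'') (Const 1)))
      (\<lambda>u \<sigma>'. search_inv \<sigma>' \<and> Suc (1 + (1 + (t + u))) + potential \<sigma>' \<le> potential (r, m))) \<sigma>1"
  proof (rule wp_mono[OF loop], elim conjE)
    fix t \<sigma>
    assume *: "neighbour_inv i xs lab \<sigma>" "fst \<sigma> ''e'' = off (Suc v)" "t \<le> Suc (20 * (off (Suc v) - off v))"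
    moreover obtain r2 m2 where "\<sigma> = (r2, m2)" by (cases \<sigma>)
    moreover have "r2 ''i'' = i" using * calculation unfolding neighbour_inv_def by simp
    ultimately show "wp (Assign ''i'' (Plus (Reg ''i'') (Const 1)))
        (\<lambda>u \<sigma>'. search_inv \<sigma>' \<and> Suc (1 + (1 + (t + u))) + potential \<sigma>' \<le> potential (r, m)) \<sigma>"
      using final[of t r2 m2] by simp
  qed
  then show ?thesis
    unfolding visit_vertex_def \<sigma>1_def v_def by (simp add: i_def[symmetric] input)
qed

lemma wp_init_loop:
  assumes "holds_input (r, m)" "r ''i'' = 0"
  shows "wp init_loop (\<lambda>t \<sigma>'. holds_input \<sigma>' \<and> t \<le> Suc (5 * card V) \<and>
    (\<forall>j<card V. snd \<sigma>' ''ord'' j = j \<and> snd \<sigma>' ''pos'' j = j \<and> snd \<sigma>' ''cell'' j = 0)) (r, m)"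
proof -
  define I where "I \<sigma> \<longleftrightarrow> holds_input \<sigma> \<and> fst \<sigma> ''i'' \<le> card V \<and>
    (\<forall>j<fst \<sigma> ''i''. snd \<sigma> ''ord'' j = j \<and> snd \<sigma> ''pos'' j = j \<and> snd \<sigma> ''cell'' j = 0)" for \<sigma> :: state
  let ?\<Phi> = "\<lambda>\<sigma> :: state. 5 * (card V - fst \<sigma> ''i'')"
  have "wp init_loop (\<lambda>t \<sigma>'. I \<sigma>' \<and> \<not> eval_test (Less (Reg ''i'') (Reg ''n'')) \<sigma>' \<and>
      t + ?\<Phi> \<sigma>' \<le> Suc (?\<Phi> (r, m))) (r, m)"
    unfolding init_loop_def
  proof (rule wp_While)
    show "I (r, m)" using assms unfolding I_def by simp
    fix \<sigma> assume "I \<sigma>" "eval_test (Less (Reg ''i'') (Reg ''n'')) \<sigma>"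
    then show "wp (Seq (Store ''ord'' (Reg ''i'') (Reg ''i''))
        (Seq (Store ''pos'' (Reg ''i'') (Reg ''i''))
        (Seq (Store ''cell'' (Reg ''i'') (Const 0))
          (Assign ''i'' (Plus (Reg ''i'') (Const 1))))))
        (\<lambda>t \<sigma>'. I \<sigma>' \<and> Suc t + ?\<Phi> \<sigma>' \<le> ?\<Phi> \<sigma>) \<sigma>"
      by (cases \<sigma>) (auto simp: I_def holds_input_def less_Suc_eq)
  qed
  then show ?thesis
    by (rule wp_mono) (auto simp: I_def holds_input_def assms)
qed

text \<open>Double counting: list entries correspond to ordered pairs of adjacent vertices, and an
  edge yields at most two such pairs.\<close>

lemma sum_degrees_le: "(\<Sum>x<card V. off (Suc x) - off x) \<le> 2 * card E"
proof -
  have finV: "finite V" and edge: "\<And>e. e \<in> E \<Longrightarrow> e \<subseteq> V \<and> card e = 2"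
    using input_simple unfolding simple_graph_def by auto
  have finE: "finite E" using finV edge by (meson finite_Pow_iff finite_subset PowI subsetI)
  let ?N = "\<lambda>x. {y. y < card V \<and> {\<nu> x, \<nu> y} \<in> E}"
  have deg: "off (Suc x) - off x = card (?N x)" if "x < card V" for x
    using bij_betw_same_card[OF bij_adj[OF that]] by simp
  have inj: "inj_on (\<lambda>(x, y). (\<nu> x, \<nu> y)) (SIGMA x:{..<card V}. ?N x)"
    using bij_betw_imp_inj_on[OF bij_\<nu>] by (auto simp: inj_on_def)
  have "(\<Sum>x<card V. off (Suc x) - off x) = card (SIGMA x:{..<card V}. ?N x)"
    by (simp add: deg)
  also have "\<dots> = card ((\<lambda>(x, y). (\<nu> x, \<nu> y)) ` (SIGMA x:{..<card V}. ?N x))"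
    using card_image[OF inj] by simp
  also have "\<dots> \<le> card (\<Union>e\<in>E. {(u, w). e = {u, w}})"
  proof (rule card_mono)
    have "(\<Union>e\<in>E. {(u, w). e = {u, w}}) \<subseteq> V \<times> V" using edge by auto
    then show "finite (\<Union>e\<in>E. {(u, w). e = {u, w}})" using finV finite_subset by blast
  qed auto
  also have "\<dots> \<le> (\<Sum>e\<in>E. card {(u, w). e = {u, w}})" by (rule card_UN_le[OF finE])
  also have "\<dots> \<le> (\<Sum>e\<in>E. 2)"
  proof (rule sum_mono)
    fix e assume "e \<in> E"
    then obtain a b where "e = {a, b}" using edge card_2_iff by metis
    then have "{(u, w). e = {u, w}} \<subseteq> {(a, b), (b, a)}" by (auto simp: doubleton_eq_iff)
    then have "card {(u, w). e = {u, w}} \<le> card {(a, b), (b, a)}" by (intro card_mono) auto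
    also have "\<dots> \<le> 2" using card_length[of "[(a, b), (b, a)]"] by simp
    finally show "card {(u, w). e = {u, w}} \<le> 2" .
  qed
  finally show ?thesis by simp
qed

lemma search_inv_initial:
  assumes "holds_input (r, m)" and "r ''i'' = 0" "r ''k'' = 1"
    and "\<And>j. j < card V \<Longrightarrow> m ''ord'' j = j \<and> m ''pos'' j = j \<and> m ''cell'' j = 0"
    and "m ''start'' 0 = 0" "m ''stamp'' 0 = 0"
  shows "search_inv (r, m)"
proof -
  have cell: "m ''cell'' ` {0..j} \<subseteq> {0}" if "j < card V" for j
    using assms(4) that by auto
  have "([], []) \<notin> lexord less_than" by simp
  \<comment> \<open>At the start there is one class, with identifier 0 and the empty label.\<close>
  then have "refinement (card V) 0 (\<lambda>x. []) (m ''ord'') (m ''pos'') (m ''cell'') (m ''start'') 1 (\<lambda>_. [])"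
    unfolding refinement_def using assms cell by (auto simp: inj_on_def)
  then show ?thesis
    unfolding search_inv_def using assms lex_bfs_run.init[of V E]
    by (auto intro!: exI[of _ "\<lambda>_. []"])
qed

lemma lex_bfs_ordering_of_permutation:
  assumes perm: "\<And>j. j < card V \<Longrightarrow> ord j < card V \<and> pos (ord j) = j" "\<And>x. x < card V \<Longrightarrow> pos x < card V \<and> ord (pos x) = x"
    and run: "lex_bfs_run V E (map (\<lambda>j. \<nu> (ord j)) [0..<card V]) lab"
  obtains \<phi> where "lex_bfs_ordering V E \<phi>" "\<And>j. j < card V \<Longrightarrow> \<phi> (\<nu> (ord j)) = j + 1"
proof -
  \<comment> \<open>\<open>Suc\<close> passes from positions counted from 0 to numbers counted from
    1.\<close>
  define \<phi> where "\<phi> v = Suc (pos (inv_into {..<card V} \<nu> v))" for v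
  have \<phi>: "\<phi> (\<nu> (ord j)) = j + 1" if "j < card V" for j
    using perm(1)[OF that] bij_betw_inv_into_left[OF bij_\<nu>, of "ord j"] unfolding \<phi>_def by simp
  have inv: "inv_into {..<card V} \<nu> v < card V" "\<nu> (inv_into {..<card V} \<nu> v) = v" if "v \<in> V" for v
    using bij_betwE[OF bij_betw_inv_into[OF bij_\<nu>]] bij_betw_inv_into_right[OF bij_\<nu>] that by auto
  have bij: "bij_betw \<phi> V {1..card V}"
  proof (rule bij_betw_byWitness[where f' = "\<lambda>i. \<nu> (ord (i - 1))"])
    show "\<forall>v\<in>V. \<nu> (ord (\<phi> v - 1)) = v" using perm(2) inv unfolding \<phi>_def by simp
    show "\<forall>i\<in>{1..card V}. \<phi> (\<nu> (ord (i - 1))) = i" using \<phi> by auto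
    show "\<phi> ` V \<subseteq> {1..card V}" using perm(2) inv unfolding \<phi>_def by (auto simp: Suc_le_eq)
    show "(\<lambda>i. \<nu> (ord (i - 1))) ` {1..card V} \<subseteq> V" using perm(1) bij_betwE[OF bij_\<nu>] by auto
  qed
  have "inv_into V \<phi> (Suc j) = \<nu> (ord j)" if "j < card V" for j
    using bij_betw_inv_into_left[OF bij, of "\<nu> (ord j)"] \<phi>[OF that] perm(1)[OF that] bij_betwE[OF bij_\<nu>]
    by auto
  then have "map (inv_into V \<phi>) [1..<Suc (card V)] = map (\<lambda>j. \<nu> (ord j)) [0..<card V]"
    by (intro nth_equalityI) (auto simp del: upt_Suc)
  then have "lex_bfs_ordering V E \<phi>" unfolding lex_bfs_ordering_def using bij run by auto
  then show thesis using \<phi> by (rule that)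
qed

text \<open>Initialization and single commands add to the bound of the search; the total is at most
  \<open>10 * card V + 40 * card E + 7\<close>, where 40 is twice the charge for a list
  entry.\<close>

lemma lex_bfs_program_correct:
  assumes "holds_input \<sigma>"
  shows "wp lex_bfs_program (\<lambda>t \<sigma>'. search_inv \<sigma>' \<and> fst \<sigma>' ''i'' = card V \<and> t \<le> 40 * (card V + card E + 1)) \<sigma>"
proof -
  obtain r m where \<sigma>: "\<sigma> = (r, m)" by (cases \<sigma>)
  let ?b = "Less (Reg ''i'') (Reg ''n'')"
  let ?Q = "\<lambda>t \<sigma>'. search_inv \<sigma>' \<and> fst \<sigma>' ''i'' = card V \<and> t \<le> Suc (5 * card V + 40 * card E)"
  have search: "wp (While ?b visit_vertex) ?Q \<sigma>0" if inv: "search_inv \<sigma>0" and i: "fst \<sigma>0 ''i'' = 0" for \<sigma>0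
  proof -
    have test: "eval_test ?b \<sigma> \<longleftrightarrow> fst \<sigma> ''i'' < card V" if "search_inv \<sigma>" for \<sigma>
      using that unfolding search_inv_def holds_input_def by simp
    have "wp visit_vertex (\<lambda>t \<sigma>'. search_inv \<sigma>' \<and> Suc t + potential \<sigma>' \<le> potential \<sigma>) \<sigma>"
      if "search_inv \<sigma>" "eval_test ?b \<sigma>" for \<sigma>
      using wp_visit_vertex[of "fst \<sigma>" "snd \<sigma>"] that test by simp
    then have "wp (While ?b visit_vertex)
        (\<lambda>t \<sigma>'. search_inv \<sigma>' \<and> \<not> eval_test ?b \<sigma>' \<and> t + potential \<sigma>' \<le> Suc (potential \<sigma>0)) \<sigma>0"
      using inv by (intro wp_While) auto
    moreover have "potential \<sigma>0 \<le> 5 * card V + 40 * card E"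
      unfolding potential_def using sum_degrees_le
      by (simp add: i sum.distrib sum_distrib_left[symmetric])
    moreover have "fst \<sigma> ''i'' = card V" if "search_inv \<sigma>" "\<not> eval_test ?b \<sigma>" for \<sigma>
      using that test[OF that(1)] unfolding search_inv_def by linarith
    ultimately show ?thesis by (elim wp_mono) force
  qed
  let ?rest = "Seq (Store ''start'' (Const 0) (Const 0))
    (Seq (Store ''stamp'' (Const 0) (Const 0))
    (Seq (Assign ''k'' (Const 1))
    (Seq (Assign ''i'' (Const 0))
      (While ?b visit_vertex))))"
  have rest: "wp ?rest (\<lambda>t \<sigma>'. search_inv \<sigma>' \<and> fst \<sigma>' ''i'' = card V \<and> t \<le> 5 + (5 * card V + 40 * card E)) (r1, m1)"
    if "holds_input (r1, m1)"
      "\<forall>j<card V. m1 ''ord'' j = j \<and> m1 ''pos'' j = j \<and> m1 ''cell'' j = 0" for r1 m1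
  proof -
    define \<sigma>0 where "\<sigma>0 = (r1(''k'' := 1, ''i'' := 0),
      m1(''start'' := (m1 ''start'')(0 := 0), ''stamp'' := (m1 ''stamp'')(0 := 0)))"
    have "search_inv \<sigma>0"
      using that unfolding \<sigma>0_def holds_input_def by (intro search_inv_initial) (auto simp: holds_input_def)
    then have "wp (While ?b visit_vertex) ?Q \<sigma>0" by (rule search) (simp add: \<sigma>0_def)
    then have "wp (While ?b visit_vertex) (\<lambda>t \<sigma>'. search_inv \<sigma>' \<and> fst \<sigma>' ''i'' = card V \<and>
        1 + (1 + (1 + (1 + t))) \<le> 5 + (5 * card V + 40 * card E)) \<sigma>0"
      by (rule wp_mono) simp
    then show ?thesis unfolding \<sigma>0_def wp_Seq wp_Store wp_Assign by simp
  qed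
  have "wp init_loop (\<lambda>t. wp ?rest (\<lambda>u \<sigma>'. search_inv \<sigma>' \<and> fst \<sigma>' ''i'' = card V \<and>
      1 + (t + u) \<le> 40 * (card V + card E + 1))) (r(''i'' := 0), m)"
  proof (rule wp_mono[OF wp_init_loop], goal_cases)
    case (3 t \<sigma>1)
    obtain r1 m1 where \<sigma>1: "\<sigma>1 = (r1, m1)" by (cases \<sigma>1)
    have t: "t \<le> Suc (5 * card V)" using 3 by blast
    have "wp ?rest (\<lambda>t \<sigma>'. search_inv \<sigma>' \<and> fst \<sigma>' ''i'' = card V \<and> t \<le> 5 + (5 * card V + 40 * card E)) \<sigma>1"
      unfolding \<sigma>1 by (rule rest) (use 3 \<sigma>1 in simp_all)
    then show ?case by (rule wp_mono) (use t in simp)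
  qed (use assms \<sigma> in \<open>auto simp: holds_input_def\<close>)
  then show ?thesis
    unfolding lex_bfs_program_def \<sigma> wp_Seq wp_Assign by simp
qed

end

theorem lex_bfs_program_computes:
  assumes "simple_graph V E"
  shows "computes_lex_bfs_ordering lex_bfs_program (40 * (card V + card E + 1)) V E"
  unfolding computes_lex_bfs_ordering_def
proof (intro allI impI)
  fix \<nu> and \<sigma> :: state
  assume input: "adjacency_lists V E \<nu> \<sigma>"
  define off where "off = snd \<sigma> ''off''"
  define adj where "adj = snd \<sigma> ''adj''"
  have lists: "lex_bfs_input V E \<nu> off adj"
    using input assms unfolding adjacency_lists_def lex_bfs_input_def off_def adj_def by simp
  have "holds_input V off adj \<sigma>" using input unfolding adjacency_lists_def holds_input_def[OF lists]
    by (simp add: off_def adj_def)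
  then obtain t \<sigma>' where exec: "exec lex_bfs_program \<sigma> t \<sigma>'" "t \<le> 40 * (card V + card E + 1)"
    and inv: "search_inv V E \<nu> off adj \<sigma>'" "fst \<sigma>' ''i'' = card V"
    using lex_bfs_program_correct[OF lists] unfolding wp_def by blast
  \<comment> \<open>With the boundary at \<open>card V\<close>, the run in the invariant has visited
    all vertices.\<close>
  obtain lab LB where run: "lex_bfs_run V E (map (\<lambda>j. \<nu> (snd \<sigma>' ''ord'' j)) [0..<card V]) lab"
    and ref: "refinement (card V) (card V) (\<lambda>x. lab (\<nu> x)) (snd \<sigma>' ''ord'') (snd \<sigma>' ''pos'') (snd \<sigma>' ''cell'')
      (snd \<sigma>' ''start'') (fst \<sigma>' ''k'') LB"
    using inv unfolding search_inv_def[OF lists] by auto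
  note R = refinementD[OF ref]
  obtain \<phi> where "lex_bfs_ordering V E \<phi>" "\<And>j. j < card V \<Longrightarrow> \<phi> (\<nu> (snd \<sigma>' ''ord'' j)) = j + 1"
    using lex_bfs_ordering_of_permutation[OF lists _ _ run] R(1-4) by blast
  then show "\<exists>t \<sigma>' \<phi>. exec lex_bfs_program \<sigma> t \<sigma>' \<and> t \<le> 40 * (card V + card E + 1) \<and>
      lex_bfs_ordering V E \<phi> \<and>
      (\<forall>i<card V. snd \<sigma>' ''ord'' i < card V \<and> \<phi> (\<nu> (snd \<sigma>' ''ord'' i)) = i + 1)"
    using exec R(1) by blast
qed

theorem theorem4:
  shows "(\<forall>(V :: 'a set) E. simple_graph V E \<and> independent_module_composed V E \<longrightarrow>
            (\<forall>\<phi>. lex_bfs_ordering V E \<phi> \<longrightarrow> independent_module_sequence V E \<phi>)) \<and>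
         (\<exists>P c. \<forall>(V :: 'a set) E. simple_graph V E \<longrightarrow>
            computes_lex_bfs_ordering P (c * (card V + card E + 1)) V E)"
  \<comment> \<open>The witnesses \<open>lex_bfs_program\<close> and \<open>40\<close> are chosen
    independently of the graph.\<close>
  using lex_bfs_ordering_independent_module_sequence lex_bfs_program_computes by blast

end
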